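(* Let assumption (A) of the context hold for the iterates of the variance-reduced heavy-ball SGD algorithm $$x_{k+1}=x_k-\alpha(\nabla f(x_k)+w_{k,N_k})+\beta(x_k-x_{k-1}),\qquad k\ge0,\quad x_{-1}=x_0,$$ and suppose that $f$ is a quadratic function with $\nabla^2f(x)\equiv\mathbf H$ for all $x\in\mathbb R^m$. Let $\kappa=L/\eta$, $\alpha=\tfrac4{(\sqrt\eta+\sqrt L)^2}$, $\beta=\big(\tfrac{\sqrt\kappa-1}{\sqrt\kappa+1}\big)^2$, and $N_k=\lceil(k+1)^v\rceil$ with $v>0$. Then there exists a constant $C(v)>0$ such that $$\mathbb E\left[\left\|\begin{pmatrix}x_{k+1}-x^*\\ x_k-x^*\end{pmatrix}\right\|^2\right]\le C(v)\,(k+1)^{-v}\qquad\forall k\ge0.$$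
   Context: Problem: minimize $f(x)=\mathbb E[F(x,\boldsymbol\xi)]$ over $x\in\mathbb R^m$, where $\boldsymbol\xi$ is an $\mathbb R^d$-valued random vector and $F:\mathbb R^m\times\mathbb R^d\to\mathbb R$. Sampled gradients $\nabla F(x,\xi)$ (gradient in $x$) are available. The algorithm starts from $x_0\in\mathbb R^m$ with positive constants $\alpha,\beta$ and positive integers $N_k$ (batch sizes); $\xi_{j,k}$ ($1\le j\le N_k$, $k\ge 0$) are i.i.d. copies of $\boldsymbol\xi$; $w_{k,N_k}=\frac1{N_k}\sum_{j=1}^{N_k}\nabla F(x_k,\xi_{j,k})-\nabla f(x_k)$; and $\mathcal F_k=\sigma\{x_0,\xi_{j,t}:1\le j\le N_t,\,0\le t\le k-1\}$, so $x_k$ is $\mathcal F_k$-measurable. Assumption (A): (i) $f$ is continuously differentiable on $\mathbb R^m$ and $\|\nabla f(x)-\nabla f(x')\|\le L\|x-x'\|$ for all $x,x'$, with $L>0$; (ii) $f$ is $\eta$-strongly convex, $\eta>0$: $(\nabla f(x)-\nabla f(x'))^T(x-x')\ge\eta\|x-x'\|^2$ for all $x,x'$; (iii) there is $\nu>0$ such that for all $k\ge0$ and $1\le j\le N_k$, almost surely $\mathbb E[\nabla F(x_k,\xi_{j,k})\mid\mathcal F_k]=\nabla f(x_k)$ and $\mathbb E[\|\nabla F(x_k,\xi_{j,k})-\nabla f(x_k)\|^2\mid\mathcal F_k]\le\nu^2$. The unique minimizer of $f$ is denoted $x^*$. *)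

theory Defs
  imports "HOL-Probability.Probability"
begin

definition grad :: "('a::real_inner \<Rightarrow> real) \<Rightarrow> 'a \<Rightarrow> 'a" where
  "grad f x = (THE D. GDERIV f x :> D)"

lemma grad_eqI:
  assumes "GDERIV f x :> D"
  shows "grad f x = D"
  unfolding grad_def
proof (rule the_equality)
  show "GDERIV f x :> D" by (rule assms)
next
  fix E assume "GDERIV f x :> E"
  then have "(\<lambda>h. h \<bullet> E) = (\<lambda>h. h \<bullet> D)"
    using assms unfolding gderiv_def by (rule has_derivative_unique)
  then have "(E - D) \<bullet> E = (E - D) \<bullet> D" by meson
  then have "(E - D) \<bullet> (E - D) = 0" by (simp only: inner_diff_right)
  then show "E = D" by simp
qed

lemma GDERIV_grad:
  fixes f :: "'a::euclidean_space \<Rightarrow> real"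
  assumes "f differentiable (at x)"
  shows "GDERIV f x :> grad f x"
proof -
  obtain f' where f': "(f has_derivative f') (at x)"
    using assms by (auto simp: differentiable_def)
  then have "linear f'" by (rule has_derivative_linear)
  then have "f' = (\<lambda>h. h \<bullet> adjoint f' 1)"
    using adjoint_works[of f'] by (auto simp: fun_eq_iff)
  then have "GDERIV f x :> adjoint f' 1" using f' unfolding gderiv_def by metis
  then show ?thesis using grad_eqI by metis
qed

definition quadratic_fun :: "(real ^ 'm \<Rightarrow> real) \<Rightarrow> bool" where
  "quadratic_fun f \<longleftrightarrow> (\<exists>A b c. \<forall>x. f x = x \<bullet> (A *v x) + b \<bullet> x + c)"

text \<open>The library only conditions real-valued functions, so vectors are conditioned
  componentwise. As with \<^const>\<open>real_cond_exp\<close>, this is meaningful for integrable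
  components only.\<close>

definition vec_cond_exp ::
    "'w measure \<Rightarrow> 'w measure \<Rightarrow> ('w \<Rightarrow> real ^ 'm) \<Rightarrow> 'w \<Rightarrow> real ^ 'm" where
  "vec_cond_exp M G X \<omega> = (\<chi> i. real_cond_exp M G (\<lambda>\<omega>'. X \<omega>' $ i) \<omega>)"

text \<open>The \<open>\<sigma>\<close>-algebra generated by \<open>x0\<close> and the batches \<open>Y j t\<close> with
  \<open>1 \<le> j \<le> N t\<close> and \<open>t \<le> k - 1\<close>; the initial point is a constant random vector.\<close>

definition history ::
    "'w measure \<Rightarrow> real ^ 'm \<Rightarrow> (nat \<Rightarrow> nat) \<Rightarrow> (nat \<Rightarrow> nat \<Rightarrow> 'w \<Rightarrow> real ^ 'd) \<Rightarrow> nat \<Rightarrow> 'w measure"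
  where
  "history M x0 N Y k = sigma (space M)
     ({(\<lambda>_. x0) -` A \<inter> space M | A. A \<in> sets borel} \<union>
      {Y j t -` A \<inter> space M | j t A. 1 \<le> j \<and> j \<le> N t \<and> t < k \<and> A \<in> sets borel})"

lemma subalgebra_history:
  assumes "\<And>j t. 1 \<le> j \<Longrightarrow> j \<le> N t \<Longrightarrow> Y j t \<in> borel_measurable M"
  shows "subalgebra M (history M x0 N Y k)"
proof -
  let ?G = "{(\<lambda>_. x0) -` A \<inter> space M | A. A \<in> sets borel} \<union>
      {Y j t -` A \<inter> space M | j t A. 1 \<le> j \<and> j \<le> N t \<and> t < k \<and> A \<in> sets borel}"
  have "?G \<subseteq> sets M"
    using assms by (auto intro!: measurable_sets[OF measurable_const] intro: measurable_sets)
  then have "sigma_sets (space M) ?G \<subseteq> sets M" by (rule sets.sigma_sets_subset)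
  moreover have "?G \<subseteq> Pow (space M)" by auto
  ultimately show ?thesis
    unfolding subalgebra_def history_def by (simp add: space_measure_of sets_measure_of)
qed

end

theory Submission
  imports Defs "HOL-Real_Asymp.Real_Asymp"
begin

text \<open>With \<open>e\<^sub>k = x\<^sub>k - x\<^sup>*\<close> the iteration is \<open>e\<^sub>k\<^sub>+\<^sub>1 = T e\<^sub>k - \<beta> e\<^sub>k\<^sub>-\<^sub>1 - \<alpha> w\<^sub>k\<close>, where
  \<open>T = (1 + \<beta>) I - \<alpha> H\<close> is self-adjoint and the choice of \<open>\<alpha>\<close>, \<open>\<beta>\<close> gives \<open>norm T \<le> 2 \<surd>\<beta>\<close>. Without noise the
  form \<open>norm a\<^sup>2 - T a \<bullet> b + \<beta> norm b\<^sup>2\<close> at \<open>(e\<^sub>k, e\<^sub>k\<^sub>-\<^sub>1)\<close> shrinks by the factor \<open>\<beta>\<close> at each step, and a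
  large multiple of it plus \<open>norm b\<^sup>2\<close> is a positive definite Lyapunov function that contracts up to
  a multiple of \<open>norm w\<^sub>k\<^sup>2\<close>. The errors of the sampled gradients within a batch are orthogonal, so
  \<open>E (norm w\<^sub>k)\<^sup>2 \<le> \<nu>\<^sup>2 / N\<^sub>k \<le> \<nu>\<^sup>2 (k + 1)\<^sup>-\<^sup>v\<close>. A recursion \<open>u\<^sub>k\<^sub>+\<^sub>1 \<le> q u\<^sub>k + B (k + 1)\<^sup>-\<^sup>v\<close> with
  \<open>q < 1\<close> forces \<open>u\<^sub>k = O((k + 1)\<^sup>-\<^sup>v)\<close>, since consecutive values of \<open>(k + 1)\<^sup>-\<^sup>v\<close> have ratio tending to \<open>1\<close>.\<close>

section \<open>A Lyapunov function for the heavy-ball recursion\<close>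

lemma bounded_selfadjoint_norm_le:
  fixes T :: "'a::real_inner \<Rightarrow> 'a"
  assumes T: "linear T" and sa: "\<And>a b. T a \<bullet> b = a \<bullet> T b"
    and bd: "\<And>a. \<bar>T a \<bullet> a\<bar> \<le> c * (norm a)\<^sup>2"
  shows "norm (T a) \<le> c * norm a"
proof (cases "T a = 0 \<or> a = 0")
  case True
  moreover have "0 \<le> c * norm a"
  proof (cases "a = 0")
    case False
    have "0 \<le> c * (norm a)\<^sup>2" using bd[of a] by linarith
    with False show ?thesis by (simp add: zero_le_mult_iff)
  qed simp
  ultimately show ?thesis using linear_0[OF T] by auto
next
  case False
  \<comment> \<open>polarization against the vector in the direction of \<open>T a\<close> of the same length as \<open>a\<close>\<close>
  define b where "b = (norm a / norm (T a)) *\<^sub>R T a"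
  have nb: "norm b = norm a" using False by (simp add: b_def)
  have "4 * (T a \<bullet> b) = T (a + b) \<bullet> (a + b) - T (a - b) \<bullet> (a - b)"
    using sa[of b a] by (simp add: linear_add[OF T] linear_diff[OF T] algebra_simps inner_commute)
  also have "\<dots> \<le> c * (norm (a + b))\<^sup>2 + c * (norm (a - b))\<^sup>2"
    using bd[of "a + b"] bd[of "a - b"] by linarith
  also have "\<dots> = c * (2 * (norm a)\<^sup>2 + 2 * (norm b)\<^sup>2)"
    unfolding power2_norm_eq_inner by (simp add: algebra_simps inner_commute)
  finally have "T a \<bullet> b \<le> c * (norm a)\<^sup>2" by (simp add: nb)
  moreover have "T a \<bullet> b = norm a * norm (T a)"
    using False by (simp add: b_def power2_norm_eq_inner[symmetric] power2_eq_square)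
  ultimately have "norm a * norm (T a) \<le> norm a * (c * norm a)"
    by (simp add: power2_eq_square mult_ac)
  with False show ?thesis by simp
qed

text \<open>Along \<open>a' = T a - r\<^sup>2 b\<close>, \<open>b' = a\<close> this quadratic form is multiplied by exactly \<open>r\<^sup>2\<close>. It is only
  positive semidefinite when \<open>norm T = 2 r\<close>, which is why \<open>(norm b)\<^sup>2\<close> is added below.\<close>

definition energy :: "('a::real_inner \<Rightarrow> 'a) \<Rightarrow> real \<Rightarrow> 'a \<Rightarrow> 'a \<Rightarrow> real" where
  "energy T r a b = (norm a)\<^sup>2 - T a \<bullet> b + r\<^sup>2 * (norm b)\<^sup>2"

text \<open>With \<open>a'\<close> for the new first argument, self-adjointness turns the new energy
  into \<open>a' \<bullet> (a' - T a) + r\<^sup>2 * (norm a)\<^sup>2\<close>. Since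
  \<open>a' - T a = n - r\<^sup>2 *\<^sub>R b\<close>, expanding the product gives the factor
  \<open>r\<^sup>2\<close> and the two noise terms.\<close>

lemma energy_step:
  assumes T: "linear T" and sa: "\<And>a b. T a \<bullet> b = a \<bullet> T b"
  shows "energy T r (T a - r\<^sup>2 *\<^sub>R b + n) a
    = r\<^sup>2 * energy T r a b + n \<bullet> (T a - (2 * r\<^sup>2) *\<^sub>R b) + (norm n)\<^sup>2"
proof -
  have e: "T (T a - r\<^sup>2 *\<^sub>R b + n) \<bullet> a = (T a - r\<^sup>2 *\<^sub>R b + n) \<bullet> T a"
    by (rule sa)
  show ?thesis
    unfolding energy_def e power2_norm_eq_inner
    by (simp add: algebra_simps inner_commute power2_eq_square)
qed

lemma energy_ge:
  assumes "norm (T a) \<le> 2 * r * norm a"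
  shows "(norm a - r * norm b)\<^sup>2 \<le> energy T r a b"
proof -
  have "T a \<bullet> b \<le> norm (T a) * norm b" by (rule norm_cauchy_schwarz)
  also have "\<dots> \<le> 2 * r * norm a * norm b" using assms by (intro mult_right_mono) auto
  finally show ?thesis unfolding energy_def by (simp add: power2_eq_square algebra_simps)
qed

text \<open>The two sides differ by \<open>(r * s - d * t)\<^sup>2 / d\<close> with
  \<open>d = p - r\<^sup>2\<close>. The point is that the weight of \<open>t\<^sup>2\<close> can be
  any \<open>p\<close> above \<open>r\<^sup>2\<close>, hence one below 1 when
  \<open>r < 1\<close>.\<close>

lemma add_square_le:
  fixes s t r p :: real
  assumes "0 \<le> r" "r\<^sup>2 < p"
  shows "(s + r * t)\<^sup>2 \<le> p / (p - r\<^sup>2) * s\<^sup>2 + p * t\<^sup>2"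
proof -
  define d where "d = p - r\<^sup>2"
  have d: "d > 0" "p = d + r\<^sup>2" using assms by (auto simp: d_def)
  have "0 \<le> (r * s - d * t)\<^sup>2 / d" using d by simp
  also have "\<dots> = p / d * s\<^sup>2 + p * t\<^sup>2 - (s + r * t)\<^sup>2"
    using d(1) unfolding d(2) by (simp add: field_simps power2_eq_square)
  finally show ?thesis by (simp add: d_def)
qed

text \<open>Without noise, one step multiplies the energy by \<open>r\<^sup>2\<close> and replaces
  \<open>(norm b)\<^sup>2\<close> by \<open>(norm a)\<^sup>2\<close>, which is at most
  \<open>c\<close> times the energy plus \<open>p * (norm b)\<^sup>2\<close>. A large weight
  \<open>K\<close> hides the extra energy in the gap between \<open>r\<^sup>2\<close> and
  \<open>p\<close>, so the sum contracts by \<open>p < 1\<close>. The noise then costs half of the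
  gap \<open>1 - p\<close>.\<close>

lemma lyapunov_contraction:
  fixes T :: "'a::real_inner \<Rightarrow> 'a"
  assumes T: "linear T" and sa: "\<And>a b. T a \<bullet> b = a \<bullet> T b"
    and bd: "\<And>a. norm (T a) \<le> 2 * r * norm a"
    and r: "0 \<le> r" "r < 1"
  obtains K q B D :: real where "0 \<le> q" "q < 1" "0 \<le> B" "0 \<le> K" "0 \<le> D"
    and "\<And>a b. (norm a)\<^sup>2 + (norm b)\<^sup>2 \<le> D * (K * energy T r a b + (norm b)\<^sup>2)"
    and "\<And>a b n. K * energy T r (T a - r\<^sup>2 *\<^sub>R b + n) a + (norm a)\<^sup>2
          \<le> q * (K * energy T r a b + (norm b)\<^sup>2) + B * (norm n)\<^sup>2"
proof -
  have r2: "r\<^sup>2 < 1" using r by (simp add: power_less_one_iff)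
  \<comment> \<open>The midpoint is above \<open>r\<^sup>2\<close>, as \<open>add_square_le\<close>
    requires, and below 1, as contraction requires.\<close>
  define p where "p = (1 + r\<^sup>2) / 2"
  have p: "r\<^sup>2 < p" "p < 1" "0 < p"
    using r2 by (auto simp: p_def add_pos_nonneg)
  define c where "c = p / (p - r\<^sup>2)"
  have c: "c > 0" using p by (simp add: c_def)
  \<comment> \<open>This is the solution of \<open>K * r\<^sup>2 + c = K * p\<close>.\<close>
  define K where "K = c / (p - r\<^sup>2)"
  have K: "K > 0" using c p by (simp add: K_def)
  have Kc: "K * r\<^sup>2 + c = K * p" using p by (simp add: K_def field_simps)
  \<comment> \<open>\<open>D * K = c + 2 * K\<close> exceeds the energy coefficient \<open>c\<close>
    in \<open>a_le\<close>, and \<open>D \<ge> 2\<close> exceeds the coefficient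
    \<open>p + 1\<close> of \<open>(norm b)\<^sup>2\<close>.\<close>
  define D where "D = c / K + 2"
  have D: "D > 0" using c K by (simp add: D_def add_pos_pos)
  \<comment> \<open>Chosen so that \<open>K * (8 * \<delta> * D) = (1 - p) / 2\<close>, the part of
    the gap granted to the noise.\<close>
  define \<delta> where "\<delta> = (1 - p) / (16 * K * D)"
  have \<delta>: "\<delta> > 0" using p K D by (simp add: \<delta>_def)
  have E0: "0 \<le> energy T r a b" for a b
    using energy_ge[where T=T and r=r and a=a and b=b, OF bd] by (meson order_trans zero_le_power2)
  have a_le: "(norm a)\<^sup>2 \<le> c * energy T r a b + p * (norm b)\<^sup>2" for a b
  proof -
    have "norm a = (norm a - r * norm b) + r * norm b" by simp
    then have "(norm a)\<^sup>2 \<le> c * (norm a - r * norm b)\<^sup>2 + p * (norm b)\<^sup>2"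
      using add_square_le[OF r(1) p(1), of "norm a - r * norm b" "norm b"] by (simp add: c_def)
    also have "\<dots> \<le> c * energy T r a b + p * (norm b)\<^sup>2"
      using energy_ge[where T=T and r=r and a=a and b=b, OF bd] c by simp
    finally show ?thesis .
  qed
  have dom: "(norm a)\<^sup>2 + (norm b)\<^sup>2 \<le> D * (K * energy T r a b + (norm b)\<^sup>2)" for a b
  proof -
    have "D * (K * energy T r a b + (norm b)\<^sup>2)
        = c * energy T r a b + 2 * (norm b)\<^sup>2 + 2 * K * energy T r a b + c / K * (norm b)\<^sup>2"
      using K by (simp add: D_def algebra_simps)
    moreover have "0 \<le> 2 * K * energy T r a b" "0 \<le> c / K * (norm b)\<^sup>2"
      using K c E0 by auto
    moreover have "p * (norm b)\<^sup>2 \<le> (norm b)\<^sup>2" using p by (simp add: mult_left_le_one_le)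
    ultimately show ?thesis using a_le[of a b] by linarith
  qed
  \<comment> \<open>the noise enters linearly; Young's inequality with a small \<open>\<delta>\<close> absorbs this term\<close>
  have cross: "n \<bullet> (T a - (2 * r\<^sup>2) *\<^sub>R b)
      \<le> 8 * \<delta> * ((norm a)\<^sup>2 + (norm b)\<^sup>2) + (norm n)\<^sup>2 / (4 * \<delta>)" for n a b
  proof -
    define z where "z = T a - (2 * r\<^sup>2) *\<^sub>R b"
    have "norm z \<le> norm (T a) + norm ((2 * r\<^sup>2) *\<^sub>R b)"
      unfolding z_def by (rule norm_triangle_ineq4)
    also have "\<dots> \<le> 2 * norm a + 2 * norm b"
    proof (rule add_mono)
      show "norm (T a) \<le> 2 * norm a"
        using bd[of a] r mult_right_mono[of r 1 "norm a"] by simp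
      show "norm ((2 * r\<^sup>2) *\<^sub>R b) \<le> 2 * norm b"
        using r2 mult_right_mono[of "r\<^sup>2" 1 "norm b"] by simp
    qed
    finally have "(norm z)\<^sup>2 \<le> (2 * norm a + 2 * norm b)\<^sup>2" by (rule power_mono) simp
    also have "\<dots> \<le> 8 * ((norm a)\<^sup>2 + (norm b)\<^sup>2)"
      using zero_le_power2[of "norm a - norm b"] by (simp add: power2_eq_square algebra_simps)
    finally have z: "(norm z)\<^sup>2 \<le> 8 * ((norm a)\<^sup>2 + (norm b)\<^sup>2)" .
    have "0 \<le> (norm n - 2 * \<delta> * norm z)\<^sup>2 / (4 * \<delta>)" using \<delta> by simp
    also have "\<dots> = \<delta> * (norm z)\<^sup>2 + (norm n)\<^sup>2 / (4 * \<delta>) - norm n * norm z"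
      using \<delta> by (simp add: field_simps power2_eq_square)
    finally have "norm n * norm z \<le> \<delta> * (norm z)\<^sup>2 + (norm n)\<^sup>2 / (4 * \<delta>)" by simp
    moreover have "n \<bullet> z \<le> norm n * norm z" by (rule norm_cauchy_schwarz)
    moreover have "\<delta> * (norm z)\<^sup>2 \<le> \<delta> * (8 * ((norm a)\<^sup>2 + (norm b)\<^sup>2))"
      using z \<delta> by (intro mult_left_mono) auto
    ultimately show ?thesis unfolding z_def by linarith
  qed
  have contr: "K * energy T r (T a - r\<^sup>2 *\<^sub>R b + n) a + (norm a)\<^sup>2
      \<le> (p + (1 - p) / 2) * (K * energy T r a b + (norm b)\<^sup>2) + K * (1 + 1 / (4 * \<delta>)) * (norm n)\<^sup>2"
    for a b n
  proof -
    define V where "V = K * energy T r a b + (norm b)\<^sup>2"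
    have "8 * \<delta> * ((norm a)\<^sup>2 + (norm b)\<^sup>2) \<le> 8 * \<delta> * (D * V)"
      using dom[of a b] \<delta> unfolding V_def by (intro mult_left_mono) auto
    with cross[of n a b] have "K * (n \<bullet> (T a - (2 * r\<^sup>2) *\<^sub>R b))
        \<le> K * (8 * \<delta> * (D * V) + (norm n)\<^sup>2 / (4 * \<delta>))"
      using K by (intro mult_left_mono) auto
    also have "\<dots> = (1 - p) / 2 * V + K / (4 * \<delta>) * (norm n)\<^sup>2"
    proof -
      have "K * (8 * \<delta> * (D * V)) = (1 - p) / 2 * V"
        using K D by (simp add: \<delta>_def)
      then show ?thesis by (simp add: algebra_simps)
    qed
    finally have 1: "K * (n \<bullet> (T a - (2 * r\<^sup>2) *\<^sub>R b)) \<le> (1 - p) / 2 * V + K / (4 * \<delta>) * (norm n)\<^sup>2" .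
    have "(K * r\<^sup>2 + c) * energy T r a b = K * p * energy T r a b" by (simp only: Kc)
    then have "K * (r\<^sup>2 * energy T r a b) + c * energy T r a b + p * (norm b)\<^sup>2 = p * V"
      unfolding V_def by (simp add: algebra_simps)
    with 1 a_le[of a b] show ?thesis
      unfolding energy_step[OF T sa] V_def[symmetric] by (simp add: algebra_simps)
  qed
  show thesis
    by (rule that[OF _ _ _ _ _ dom contr]) (use p K D \<delta> in \<open>auto simp: field_simps\<close>)
qed

text \<open>The bound \<open>C * p k\<close> passes to the next index once
  \<open>q * p k \<le> q' * p (Suc k)\<close> with \<open>q' < 1\<close> and \<open>C\<close> is at
  least \<open>B * 2 powr v / (1 - q')\<close>. The first condition holds from some
  \<open>k0\<close> on; the finitely many earlier indices are covered by enlarging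
  \<open>C\<close>.\<close>

lemma powr_decay_recursion:
  fixes u :: "nat \<Rightarrow> real"
  assumes step: "\<And>k. u (Suc k) \<le> q * u k + B * (real k + 1) powr (- v)"
    and q: "0 \<le> q" "q < 1" and B: "0 \<le> B" and v: "0 < v" and u: "\<And>k. 0 \<le> u k"
  obtains C where "C > 0" "\<And>k. u k \<le> C * (real k + 1) powr (- v)"
proof -
  define p where "p k = (real k + 1) powr (- v)" for k :: nat
  have p: "p k > 0" for k by (simp add: p_def)
  \<comment> \<open>The slack between \<open>q\<close> and \<open>q'\<close> absorbs the ratio
    \<open>p k / p (Suc k)\<close>, which exceeds 1 but tends to 1.\<close>
  define q' where "q' = (1 + q) / 2"
  have q': "q < q'" "q' < 1" "0 < q'" using q by (auto simp: q'_def)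
  have "(\<lambda>k. p k / p (Suc k)) \<longlonglongrightarrow> 1" unfolding p_def by real_asymp
  then have "(\<lambda>k. q * (p k / p (Suc k))) \<longlonglongrightarrow> q * 1" by (intro tendsto_intros)
  then have "\<forall>\<^sub>F k in sequentially. q * (p k / p (Suc k)) < q'"
    using q'(1) by (intro order_tendstoD(2)) auto
  then obtain k0 where k0: "\<And>k. k \<ge> k0 \<Longrightarrow> q * (p k / p (Suc k)) < q'"
    by (auto simp: eventually_sequentially)
  have k0': "q * p k \<le> q' * p (Suc k)" if "k \<ge> k0" for k
    using k0[OF that] p[of "Suc k"] by (simp add: field_simps)
  \<comment> \<open>This rests on \<open>k + 2 \<le> 2 * (k + 1)\<close> and, unlike the bound with
    \<open>q'\<close>, holds for every \<open>k\<close>.\<close>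
  have p2: "p k \<le> 2 powr v * p (Suc k)" for k
  proof -
    have "p k = 2 powr v * (2 * (real k + 1)) powr (- v)"
      unfolding p_def by (subst powr_mult) (auto simp: powr_minus field_simps)
    also have "\<dots> \<le> 2 powr v * p (Suc k)"
      unfolding p_def using v by (intro mult_left_mono powr_mono2') auto
    finally show ?thesis .
  qed
  \<comment> \<open>The summand 1 gives positivity, the sum handles the indices up to
    \<open>k0\<close>, and the last term absorbs the inhomogeneity of the recursion.\<close>
  define C where "C = 1 + (\<Sum>k\<le>k0. u k / p k) + B * 2 powr v / (1 - q')"
  have S0: "0 \<le> (\<Sum>k\<le>k0. u k / p k)" using u p by (intro sum_nonneg) (simp add: less_imp_le)
  have B0: "0 \<le> B * 2 powr v / (1 - q')" using B q' by simp
  have C: "C > 0" using S0 B0 by (simp add: C_def)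
  have CB: "B * 2 powr v \<le> (1 - q') * C"
  proof -
    have "B * 2 powr v = (1 - q') * (B * 2 powr v / (1 - q'))" using q' by simp
    also have "\<dots> \<le> (1 - q') * C" using S0 q' by (intro mult_left_mono) (auto simp: C_def)
    finally show ?thesis .
  qed
  have init: "u k \<le> C * p k" if "k \<le> k0" for k
  proof -
    have "u k / p k \<le> (\<Sum>k\<le>k0. u k / p k)"
      using that u p by (intro member_le_sum) (auto simp: less_imp_le)
    then have "u k / p k \<le> C" using B0 by (simp add: C_def)
    then show ?thesis using p[of k] by (simp add: field_simps)
  qed
  have "u k \<le> C * p k" for k
  proof (induction k)
    case 0 show ?case by (rule init) simp
  next
    case (Suc k)
    show ?case
    proof (cases "Suc k \<le> k0")
      case True then show ?thesis by (rule init)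
    next
      case False
      have "u (Suc k) \<le> q * u k + B * p k" using step[of k] by (simp add: p_def)
      also have "\<dots> \<le> q * (C * p k) + B * (2 powr v * p (Suc k))"
        using Suc p2[of k] q B by (intro add_mono mult_left_mono) auto
      also have "\<dots> = C * (q * p k) + (B * 2 powr v) * p (Suc k)" by simp
      also have "\<dots> \<le> C * (q' * p (Suc k)) + ((1 - q') * C) * p (Suc k)"
        using False k0'[of k] CB C p[of "Suc k"] by (intro add_mono mult_left_mono mult_right_mono) auto
      also have "\<dots> = C * p (Suc k)" by (simp add: algebra_simps)
      finally show ?thesis .
    qed
  qed
  with C show thesis by (intro that) (auto simp: p_def)
qed

section \<open>Quadratic objective and choice of parameters\<close>

lemma GDERIV_quadratic:
  fixes A :: "real ^ 'm ^ 'm"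
  shows "GDERIV (\<lambda>x. x \<bullet> (A *v x) + b \<bullet> x + c) x :> (A + transpose A) *v x + b"
  unfolding gderiv_def
proof (rule has_derivative_eq_rhs)
  show "((\<lambda>x. x \<bullet> (A *v x) + b \<bullet> x + c) has_derivative
      (\<lambda>h. x \<bullet> (A *v h) + h \<bullet> (A *v x) + b \<bullet> h + 0)) (at x)"
    by (intro derivative_intros) (auto intro!: derivative_eq_intros simp: bounded_linear_imp_has_derivative)
  show "(\<lambda>h. x \<bullet> (A *v h) + h \<bullet> (A *v x) + b \<bullet> h + 0) = (\<lambda>h. h \<bullet> ((A + transpose A) *v x + b))"
    by (auto simp: fun_eq_iff matrix_vector_mult_add_rdistrib inner_add_right dot_lmul_matrix[symmetric] inner_commute)
qed

text \<open>Symmetry of \<open>H\<close> is derived: the matrix \<open>A\<close> of the quadratic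
  form may be asymmetric, but the gradient has linear part \<open>A + transpose A\<close>, and
  uniqueness of derivatives identifies \<open>H\<close> with it.\<close>

lemma quadratic_hessian_selfadjoint:
  fixes f :: "real ^ 'm \<Rightarrow> real"
  assumes "quadratic_fun f" and H: "\<And>u. (grad f has_derivative (\<lambda>h. H *v h)) (at u)"
  shows "(H *v a) \<bullet> b = a \<bullet> (H *v b)"
    and "grad f u - grad f u' = H *v (u - u')"
proof -
  obtain A b' c where f: "f = (\<lambda>x. x \<bullet> (A *v x) + b' \<bullet> x + c)"
    using assms(1) by (auto simp: quadratic_fun_def fun_eq_iff)
  define S where "S = A + transpose A"
  have g: "grad f = (\<lambda>x. S *v x + b')"
    unfolding f S_def by (rule ext) (rule grad_eqI, rule GDERIV_quadratic)
  have "((\<lambda>x. S *v x + b') has_derivative (\<lambda>h. S *v h)) (at 0)"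
    by (auto intro!: derivative_eq_intros bounded_linear_imp_has_derivative)
  with H[of 0] have "(\<lambda>h. H *v h) = (\<lambda>h. S *v h)"
    unfolding g by (rule has_derivative_unique)
  then have HS: "H *v h = S *v h" for h by (rule fun_cong)
  have "transpose S = S" unfolding S_def by (simp add: transpose_def vec_eq_iff add.commute)
  then show "(H *v a) \<bullet> b = a \<bullet> (H *v b)"
    unfolding HS by (metis dot_lmul_matrix inner_commute transpose_matrix_vector)
  show "grad f u - grad f u' = H *v (u - u')"
    unfolding HS g by (simp add: matrix_vector_mult_diff_distrib)
qed

text \<open>The last two identities place the spectrum of \<open>\<alpha>\<close> times the Hessian
  in an interval centred at \<open>1 + r\<^sup>2\<close> with half-width \<open>2 * r\<close>. Hence
  subtracting it from \<open>1 + \<beta>\<close> leaves a map of norm at most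
  \<open>2 * r\<close>.\<close>

lemma heavy_ball_parameters:
  fixes \<eta> L \<kappa> \<alpha> \<beta> :: real
  assumes "0 < \<eta>" "\<eta> \<le> L" "\<kappa> = L / \<eta>" "\<alpha> = 4 / (sqrt \<eta> + sqrt L)\<^sup>2"
    "\<beta> = ((sqrt \<kappa> - 1) / (sqrt \<kappa> + 1))\<^sup>2"
  defines "r \<equiv> (sqrt L - sqrt \<eta>) / (sqrt L + sqrt \<eta>)"
  shows "0 \<le> r" "r < 1" "\<beta> = r\<^sup>2" "\<alpha> > 0" "\<alpha> * \<eta> = (1 - r)\<^sup>2" "\<alpha> * L = (1 + r)\<^sup>2"
proof -
  define s t where "s = sqrt \<eta>" and "t = sqrt L"
  have st: "0 < s" "s \<le> t" "0 < t" "\<eta> = s\<^sup>2" "L = t\<^sup>2" using assms(1,2) by (auto simp: s_def t_def)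
  have r: "r = (t - s) / (t + s)" by (simp add: r_def s_def t_def)
  show "0 \<le> r" "r < 1" using st by (auto simp: r field_simps)
  have k: "sqrt \<kappa> = t / s" by (simp add: assms(3) s_def t_def real_sqrt_divide)
  have "(sqrt \<kappa> - 1) / (sqrt \<kappa> + 1) = r"
    unfolding k r using st(1-3) by (simp add: divide_simps add_pos_pos less_imp_neq[symmetric])
  then show "\<beta> = r\<^sup>2" by (simp add: assms(5))
  have \<alpha>: "\<alpha> = 4 / (s + t)\<^sup>2" by (simp add: assms(4) s_def t_def)
  show "\<alpha> > 0" using st by (simp add: \<alpha>)
  have "1 - r = 2 * s / (s + t)" "1 + r = 2 * t / (s + t)" using st by (auto simp: r divide_simps)
  then show "\<alpha> * \<eta> = (1 - r)\<^sup>2" "\<alpha> * L = (1 + r)\<^sup>2"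
    unfolding \<alpha> st(4,5) by (auto simp: power_divide power_mult_distrib)
qed

section \<open>Square-integrable noise\<close>

lemma borel_measurable_Caratheodory:
  fixes F :: "'a::{second_countable_topology,metric_space} \<Rightarrow> 'b \<Rightarrow> real"
  assumes F [measurable]: "\<And>u. F u \<in> borel_measurable S"
    and cont: "\<And>y. y \<in> space S \<Longrightarrow> continuous_on UNIV (\<lambda>u. F u y)"
  shows "(\<lambda>p. F (fst p) (snd p)) \<in> borel_measurable (borel \<Otimes>\<^sub>M S)"
proof -
  \<comment> \<open>move the first argument to the first point of a dense sequence within distance \<open>1/(n+1)\<close>\<close>
  obtain D :: "'a set" where D: "countable D" "\<And>X. open X \<Longrightarrow> X \<noteq> {} \<Longrightarrow> \<exists>d\<in>D. d \<in> X"
    by (rule countable_dense_setE) blast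
  define d where "d = from_nat_into D"
  have ex: "\<exists>i. dist (d i) u < e" if e: "e > 0" for u e
  proof -
    obtain z where z: "z \<in> D" "z \<in> ball u e"
      using D(2)[of "ball u e"] e by auto
    obtain i where "d i = z" using from_nat_into_surj[OF D(1) z(1)] by (auto simp: d_def)
    then show ?thesis using z(2) by (auto simp: dist_commute)
  qed
  \<comment> \<open>Taking the least index makes \<open>l n\<close> measurable with values in a
    countable set, so each approximant is patched together from countably many functions of the
    second argument alone.\<close>
  define l where "l n u = (LEAST i. dist (d i) u < inverse (real (Suc n)))" for n u
  have l: "dist (d (l n u)) u < inverse (real (Suc n))" for n u
    unfolding l_def by (rule LeastI_ex, rule ex) simp
  have lm: "(\<lambda>p. l n (fst p)) \<in> measurable (borel \<Otimes>\<^sub>M S) (count_space UNIV)" for n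
    unfolding l_def by measurable
  show ?thesis
  proof (rule borel_measurable_LIMSEQ_real)
    show "(\<lambda>n. F (d (l n (fst p))) (snd p)) \<longlonglongrightarrow> F (fst p) (snd p)"
      if "p \<in> space (borel \<Otimes>\<^sub>M S)" for p
    proof (rule isCont_tendsto_compose[where g = "\<lambda>u. F u (snd p)"])
      have "snd p \<in> space S" using that by (auto simp: space_pair_measure)
      from cont[OF this] show "isCont (\<lambda>u. F u (snd p)) (fst p)"
        by (simp add: continuous_on_eq_continuous_at)
      show "(\<lambda>n. d (l n (fst p))) \<longlonglongrightarrow> fst p"
        by (rule metric_tendsto_imp_tendsto[OF LIMSEQ_inverse_real_of_nat])
           (use l in \<open>auto intro!: always_eventually less_imp_le\<close>)
    qed
    show "(\<lambda>p. F (d (l n (fst p))) (snd p)) \<in> borel_measurable (borel \<Otimes>\<^sub>M S)" for n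
      by (rule measurable_compose_countable[OF _ lm, where f = "\<lambda>i p. F (d i) (snd p)"]) measurable
  qed
qed

lemma difference_quotient_tendsto_grad:
  fixes h :: "'a::euclidean_space \<Rightarrow> real"
  assumes "h differentiable (at u)"
  shows "(\<lambda>n. (h (u + inverse (real (Suc n)) *\<^sub>R b) - h u) * real (Suc n)) \<longlonglongrightarrow> grad h u \<bullet> b"
proof -
  \<comment> \<open>The base point is written \<open>u + 0 *\<^sub>R b\<close> to match the value of
    the inner map at 0 in the chain rule.\<close>
  have g: "(h has_derivative (\<lambda>z. z \<bullet> grad h u)) (at (u + 0 *\<^sub>R b))"
    using GDERIV_grad[OF assms] by (simp add: gderiv_def)
  have "((\<lambda>t. u + t *\<^sub>R b) has_derivative (\<lambda>t. t *\<^sub>R b)) (at 0)"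
    by (auto intro!: derivative_eq_intros)
  from diff_chain_at[OF this g]
  have "((\<lambda>t. h (u + t *\<^sub>R b)) has_derivative (\<lambda>t. t * (grad h u \<bullet> b))) (at 0)"
    by (simp add: o_def inner_commute)
  then have "DERIV (\<lambda>t. h (u + t *\<^sub>R b)) 0 :> grad h u \<bullet> b"
    by (simp add: has_field_derivative_def mult.commute[of _ "grad h u \<bullet> b"] mult_commute_abs)
  then have "(\<lambda>t. (h (u + t *\<^sub>R b) - h u) / t) \<midarrow>0\<rightarrow> grad h u \<bullet> b"
    by (simp add: DERIV_def)
  then have "(\<lambda>n. (h (u + inverse (real (Suc n)) *\<^sub>R b) - h u) / inverse (real (Suc n))) \<longlonglongrightarrow> grad h u \<bullet> b"
    using LIMSEQ_inverse_real_of_nat unfolding LIMSEQ_SEQ_conv[symmetric]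
    by (elim allE[where x = "\<lambda>n. inverse (real (Suc n))"]) simp
  then show ?thesis by (simp add: divide_inverse)
qed

text \<open>Each component is a limit of difference quotients, and these are jointly measurable
  because \<open>F\<close> is measurable in the sample and, being differentiable, continuous in the
  point. Joint measurability is needed since both the point and the sample will be random.\<close>

lemma borel_measurable_grad:
  fixes F :: "'a::euclidean_space \<Rightarrow> 'b \<Rightarrow> real"
  assumes F: "\<And>u. F u \<in> borel_measurable S"
    and diff: "\<And>u y. y \<in> space S \<Longrightarrow> (\<lambda>u'. F u' y) differentiable (at u)"
  shows "(\<lambda>p. grad (\<lambda>u. F u (snd p)) (fst p)) \<in> borel_measurable (borel \<Otimes>\<^sub>M S)"
proof (subst borel_measurable_euclidean_space, rule ballI, rule borel_measurable_LIMSEQ_real)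
  have [measurable]: "(\<lambda>p. F (fst p) (snd p)) \<in> borel_measurable (borel \<Otimes>\<^sub>M S)"
    using differentiable_imp_continuous_within[OF diff]
    by (intro borel_measurable_Caratheodory F) (simp add: continuous_on_eq_continuous_at)
  fix b :: 'a
  show "(\<lambda>p. (F (fst p + inverse (real (Suc n)) *\<^sub>R b) (snd p) - F (fst p) (snd p)) * real (Suc n))
      \<in> borel_measurable (borel \<Otimes>\<^sub>M S)" for n
  proof -
    have [measurable]: "(\<lambda>p. F (fst p + inverse (real (Suc n)) *\<^sub>R b) (snd p)) \<in> borel_measurable (borel \<Otimes>\<^sub>M S)"
      using measurable_compose[where f = "\<lambda>p. (fst p + inverse (real (Suc n)) *\<^sub>R b, snd p)"
          and M = "borel \<Otimes>\<^sub>M S" and N = "borel \<Otimes>\<^sub>M S" and g = "\<lambda>p. F (fst p) (snd p)"]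
      by simp
    show ?thesis by measurable
  qed
  show "(\<lambda>n. (F (fst p + inverse (real (Suc n)) *\<^sub>R b) (snd p) - F (fst p) (snd p)) * real (Suc n))
      \<longlonglongrightarrow> grad (\<lambda>u. F u (snd p)) (fst p) \<bullet> b"
    if "p \<in> space (borel \<Otimes>\<^sub>M S)" for p
    by (rule difference_quotient_tendsto_grad, rule diff) (use that in \<open>auto simp: space_pair_measure\<close>)
qed

section \<open>Independence and orthogonality of the sampling errors\<close>

lemma integrable_mult_L2:
  fixes f g :: "'a \<Rightarrow> real"
  assumes "f \<in> borel_measurable M" "g \<in> borel_measurable M"
    and "integrable M (\<lambda>x. (f x)\<^sup>2)" "integrable M (\<lambda>x. (g x)\<^sup>2)"
  shows "integrable M (\<lambda>x. f x * g x)"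
proof (rule Bochner_Integration.integrable_bound)
  show "integrable M (\<lambda>x. (f x)\<^sup>2 + (g x)\<^sup>2)" using assms by simp
  show "AE x in M. norm (f x * g x) \<le> norm ((f x)\<^sup>2 + (g x)\<^sup>2)"
  proof (rule AE_I2)
    fix x
    have "2 * (\<bar>f x\<bar> * \<bar>g x\<bar>) \<le> (f x)\<^sup>2 + (g x)\<^sup>2"
      using zero_le_power2[of "\<bar>f x\<bar> - \<bar>g x\<bar>"] by (simp add: power2_eq_square algebra_simps)
    moreover have "norm (f x * g x) = \<bar>f x\<bar> * \<bar>g x\<bar>" "0 \<le> norm (f x * g x)"
      by (simp_all add: abs_mult)
    ultimately show "norm (f x * g x) \<le> norm ((f x)\<^sup>2 + (g x)\<^sup>2)"
      using abs_ge_self[of "(f x)\<^sup>2 + (g x)\<^sup>2"] unfolding real_norm_def by linarith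
  qed
qed (use assms in measurable)

text \<open>Independence is expressed by product distributions because \<^const>\<open>prob_space.indep_var\<close>
  requires both variables to take values in the same type. The inner integral of \<open>\<phi> u\<close> against the
  law of \<open>Z\<close> vanishes for almost every \<open>u\<close>; the claim then follows by Fubini.\<close>

lemma (in prob_space) indep_copies_orthogonal:
  fixes \<phi> :: "'x \<Rightarrow> 'y \<Rightarrow> real"
  assumes XYZ [measurable]: "X \<in> measurable M S" "Y \<in> measurable M T" "Z \<in> measurable M T"
    and dYZ: "distr M T Y \<Otimes>\<^sub>M distr M T Z = distr M (T \<Otimes>\<^sub>M T) (\<lambda>\<omega>. (Y \<omega>, Z \<omega>))"
    and dXZ: "distr M S X \<Otimes>\<^sub>M distr M T Z = distr M (S \<Otimes>\<^sub>M T) (\<lambda>\<omega>. (X \<omega>, Z \<omega>))"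
    and dXYZ: "distr M S X \<Otimes>\<^sub>M distr M (T \<Otimes>\<^sub>M T) (\<lambda>\<omega>. (Y \<omega>, Z \<omega>))
      = distr M (S \<Otimes>\<^sub>M (T \<Otimes>\<^sub>M T)) (\<lambda>\<omega>. (X \<omega>, Y \<omega>, Z \<omega>))"
    and \<phi> [measurable]: "(\<lambda>p. \<phi> (fst p) (snd p)) \<in> borel_measurable (S \<Otimes>\<^sub>M T)"
    and sqY: "integrable M (\<lambda>\<omega>. (\<phi> (X \<omega>) (Y \<omega>))\<^sup>2)"
    and sqZ: "integrable M (\<lambda>\<omega>. (\<phi> (X \<omega>) (Z \<omega>))\<^sup>2)"
    and zero: "\<And>A. A \<in> sets S \<Longrightarrow> expectation (\<lambda>\<omega>. indicator A (X \<omega>) * \<phi> (X \<omega>) (Z \<omega>)) = 0"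
  shows "expectation (\<lambda>\<omega>. \<phi> (X \<omega>) (Y \<omega>) * \<phi> (X \<omega>) (Z \<omega>)) = 0"
proof -
  define mx my mz where "mx = distr M S X" and "my = distr M T Y" and "mz = distr M T Z"
  have sets_m [measurable_cong]: "sets mx = sets S" "sets my = sets T" "sets mz = sets T"
    by (auto simp: mx_def my_def mz_def)
  interpret X: prob_space mx unfolding mx_def by (rule prob_space_distr) simp
  interpret Y: prob_space my unfolding my_def by (rule prob_space_distr) simp
  interpret Z: prob_space mz unfolding mz_def by (rule prob_space_distr) simp
  interpret YZ: pair_prob_space my mz ..
  interpret XZ: pair_prob_space mx mz ..
  interpret XYZ: pair_prob_space mx "my \<Otimes>\<^sub>M mz" ..
  note dXZ = dXZ[folded mx_def mz_def]
  note dXYZ = dXYZ[folded dYZ, folded mx_def my_def mz_def]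
  have pY: "(\<lambda>\<omega>. \<phi> (X \<omega>) (Y \<omega>)) \<in> borel_measurable M"
    using measurable_compose[OF _ \<phi>, of "\<lambda>\<omega>. (X \<omega>, Y \<omega>)"] by simp
  have pZ: "(\<lambda>\<omega>. \<phi> (X \<omega>) (Z \<omega>)) \<in> borel_measurable M"
    using measurable_compose[OF _ \<phi>, of "\<lambda>\<omega>. (X \<omega>, Z \<omega>)"] by simp
  have intZ: "integrable (mx \<Otimes>\<^sub>M mz) (\<lambda>p. \<phi> (fst p) (snd p))"
    unfolding dXZ using square_integrable_imp_integrable[OF pZ sqZ]
    by (subst integrable_distr_eq) auto
  define g where "g u = (\<integral>z. \<phi> u z \<partial>mz)" for u
  have g_int: "integrable mx g"
    using XZ.integrable_fst'[OF intZ] by (simp add: g_def[abs_def])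
  have "AE u in mx. g u = 0"
  proof (rule X.density_zero[OF g_int])
    fix A assume "A \<in> sets mx"
    then have A [measurable]: "A \<in> sets S" by (simp add: sets_m)
    have int: "integrable (mx \<Otimes>\<^sub>M mz) (\<lambda>p. indicator A (fst p) * \<phi> (fst p) (snd p))"
    proof (rule Bochner_Integration.integrable_bound[OF intZ])
      show "(\<lambda>p. indicator A (fst p) * \<phi> (fst p) (snd p)) \<in> borel_measurable (mx \<Otimes>\<^sub>M mz)"
        by measurable
    qed (auto split: split_indicator)
    have "(\<integral>u\<in>A. g u \<partial>mx) = (\<integral>u. \<integral>z. indicator A u * \<phi> u z \<partial>mz \<partial>mx)"
      by (simp add: set_lebesgue_integral_def g_def)
    also have "\<dots> = (\<integral>p. indicator A (fst p) * \<phi> (fst p) (snd p) \<partial>(mx \<Otimes>\<^sub>M mz))"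
      using XZ.integral_fst'[OF int] by simp
    also have "\<dots> = expectation (\<lambda>\<omega>. indicator A (X \<omega>) * \<phi> (X \<omega>) (Z \<omega>))"
      unfolding dXZ by (subst integral_distr) auto
    finally show "(\<integral>u\<in>A. g u \<partial>mx) = 0" using zero[OF A] by simp
  qed
  have int_prod: "integrable M (\<lambda>\<omega>. \<phi> (X \<omega>) (Y \<omega>) * \<phi> (X \<omega>) (Z \<omega>))"
    by (rule integrable_mult_L2[OF pY pZ sqY sqZ])
  have [measurable]: "(\<lambda>p. \<phi> (fst p) (fst (snd p))) \<in> borel_measurable (S \<Otimes>\<^sub>M (T \<Otimes>\<^sub>M T))"
    using measurable_compose[OF _ \<phi>, of "\<lambda>p. (fst p, fst (snd p))" "S \<Otimes>\<^sub>M (T \<Otimes>\<^sub>M T)"] by simp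
  have [measurable]: "(\<lambda>p. \<phi> (fst p) (snd (snd p))) \<in> borel_measurable (S \<Otimes>\<^sub>M (T \<Otimes>\<^sub>M T))"
    using measurable_compose[OF _ \<phi>, of "\<lambda>p. (fst p, snd (snd p))" "S \<Otimes>\<^sub>M (T \<Otimes>\<^sub>M T)"] by simp
  define \<psi> where "\<psi> p = \<phi> (fst p) (fst (snd p)) * \<phi> (fst p) (snd (snd p))" for p
  have [measurable]: "\<psi> \<in> borel_measurable (S \<Otimes>\<^sub>M (T \<Otimes>\<^sub>M T))"
    unfolding \<psi>_def[abs_def] by measurable
  have \<psi>_int: "integrable (mx \<Otimes>\<^sub>M (my \<Otimes>\<^sub>M mz)) \<psi>"
    unfolding dXYZ using int_prod by (subst integrable_distr_eq) (auto simp: \<psi>_def)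
  have "expectation (\<lambda>\<omega>. \<phi> (X \<omega>) (Y \<omega>) * \<phi> (X \<omega>) (Z \<omega>)) = integral\<^sup>L (mx \<Otimes>\<^sub>M (my \<Otimes>\<^sub>M mz)) \<psi>"
    unfolding dXYZ by (subst integral_distr) (auto simp: \<psi>_def)
  also have "\<dots> = (\<integral>u. \<integral>q. \<psi> (u, q) \<partial>(my \<Otimes>\<^sub>M mz) \<partial>mx)"
    by (rule XYZ.integral_fst'[OF \<psi>_int, symmetric])
  also have "\<dots> = 0"
  proof (rule integral_eq_zero_AE)
    show "AE u in mx. (\<integral>q. \<psi> (u, q) \<partial>(my \<Otimes>\<^sub>M mz)) = 0"
      using XYZ.AE_integrable_fst'[OF \<psi>_int] \<open>AE u in mx. g u = 0\<close>
    proof eventually_elim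
      fix u assume u: "integrable (my \<Otimes>\<^sub>M mz) (\<lambda>q. \<psi> (u, q))" "g u = 0"
      have "(\<integral>q. \<psi> (u, q) \<partial>(my \<Otimes>\<^sub>M mz)) = (\<integral>y. \<integral>z. \<phi> u y * \<phi> u z \<partial>mz \<partial>my)"
        using YZ.integral_fst'[OF u(1)] by (simp add: \<psi>_def)
      also have "\<dots> = 0" using u(2) by (simp add: g_def)
      finally show "(\<integral>q. \<psi> (u, q) \<partial>(my \<Otimes>\<^sub>M mz)) = 0" .
    qed
  qed
  finally show ?thesis .
qed

text \<open>Disjoint groups of an independent family generate independent sigma-algebras. This gives
  the product formula on rectangles, which determine the joint law. It serves for the past against
  one sample, for two samples of a batch, and for the past against such a pair.\<close>

lemma (in prob_space) joint_distr_indep_generated: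
  assumes ind: "indep_vars (\<lambda>_. N) Y I" and AB: "A \<subseteq> I" "B \<subseteq> I" "A \<inter> B = {}"
    and X: "X \<in> measurable (sigma (space M) (\<Union>i\<in>A. {Y i -` C \<inter> space M | C. C \<in> sets N})) S"
    and Z: "Z \<in> measurable (sigma (space M) (\<Union>i\<in>B. {Y i -` C \<inter> space M | C. C \<in> sets N})) T"
  shows "distr M S X \<Otimes>\<^sub>M distr M T Z = distr M (S \<Otimes>\<^sub>M T) (\<lambda>\<omega>. (X \<omega>, Z \<omega>))"
proof -
  define E where "E i = {Y i -` C \<inter> space M | C. C \<in> sets N}" for i
  have Ym: "i \<in> I \<Longrightarrow> Y i \<in> measurable M N" for i
    using ind by (auto simp: indep_vars_def2)
  have E: "indep_sets E I" using ind by (simp add: indep_vars_def2 E_def[abs_def])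
  \<comment> \<open>Closure under intersection is what lets independence pass from the generators to
    the sigma-algebras of whole groups.\<close>
  have stable: "Int_stable (E i)" for i
  proof (rule Int_stableI)
    fix a b assume "a \<in> E i" "b \<in> E i"
    then obtain C D where "a = Y i -` C \<inter> space M" "b = Y i -` D \<inter> space M" "C \<in> sets N" "D \<in> sets N"
      by (auto simp: E_def)
    then show "a \<inter> b \<in> E i" unfolding E_def by (intro CollectI exI[of _ "C \<inter> D"]) auto
  qed
  have sub: "(\<Union>i\<in>J. E i) \<subseteq> Pow (space M)" for J by (auto simp: E_def)
  define SA SB where "SA = sigma_sets (space M) (\<Union>i\<in>A. E i)" and "SB = sigma_sets (space M) (\<Union>i\<in>B. E i)"
  have "indep_sets (\<lambda>j. sigma_sets (space M) (\<Union>i\<in>(case_bool A B j). E i)) (UNIV :: bool set)"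
  proof (rule indep_sets_collect_sigma)
    show "indep_sets E (\<Union>j\<in>UNIV. case_bool A B j)"
      by (rule indep_sets_mono_index[OF _ E]) (use AB in \<open>auto split: bool.splits\<close>)
    show "disjoint_family_on (case_bool A B) UNIV"
      using AB(3) by (auto simp: disjoint_family_on_def split: bool.splits)
  qed (rule stable)
  also have "(\<lambda>j. sigma_sets (space M) (\<Union>i\<in>(case_bool A B j). E i)) = case_bool SA SB"
    by (auto simp: fun_eq_iff SA_def SB_def split: bool.splits)
  finally have "indep_set SA SB" by (simp add: indep_set_def)
  then have S: "SA \<subseteq> events" "SB \<subseteq> events" "\<And>a b. a \<in> SA \<Longrightarrow> b \<in> SB \<Longrightarrow> prob (a \<inter> b) = prob a * prob b"
    by (auto simp: indep_sets2_eq)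
  have XS: "C \<in> sets S \<Longrightarrow> X -` C \<inter> space M \<in> SA" for C
    using measurable_sets[OF X] sub by (simp add: SA_def E_def[symmetric])
  have ZS: "C \<in> sets T \<Longrightarrow> Z -` C \<inter> space M \<in> SB" for C
    using measurable_sets[OF Z] sub by (simp add: SB_def E_def[symmetric])
  have Xs: "X \<in> measurable M S"
    using X XS S(1) sub unfolding measurable_def by (auto simp: E_def[symmetric])
  have Zs: "Z \<in> measurable M T"
    using Z ZS S(2) sub unfolding measurable_def by (auto simp: E_def[symmetric])
  note [measurable] = Xs Zs
  interpret X: prob_space "distr M S X" by (rule prob_space_distr) simp
  interpret Z: prob_space "distr M T Z" by (rule prob_space_distr) simp
  show ?thesis
  proof (rule pair_measure_eqI)
    fix C D assume "C \<in> sets (distr M S X)" "D \<in> sets (distr M T Z)"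
    then have CD [measurable]: "C \<in> sets S" "D \<in> sets T" by auto
    have "(\<lambda>\<omega>. (X \<omega>, Z \<omega>)) -` (C \<times> D) \<inter> space M = (X -` C \<inter> space M) \<inter> (Z -` D \<inter> space M)"
      by auto
    then show "emeasure (distr M S X) C * emeasure (distr M T Z) D
        = emeasure (distr M (S \<Otimes>\<^sub>M T) (\<lambda>\<omega>. (X \<omega>, Z \<omega>))) (C \<times> D)"
      using S(3)[OF XS ZS, OF CD] CD
      by (simp add: emeasure_distr emeasure_eq_measure ennreal_mult'')
  qed (auto intro: X.sigma_finite_measure_axioms Z.sigma_finite_measure_axioms)
qed

section \<open>Second moments of batch sums\<close>

lemma integrable_norm_square_bound:
  fixes h :: "'a \<Rightarrow> 'b::{second_countable_topology,real_normed_vector}"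
    and g :: "'a \<Rightarrow> 'c::real_normed_vector"
  assumes [measurable]: "h \<in> borel_measurable M"
    and le: "\<And>x. norm (h x) \<le> c * norm (g x)" and sq: "integrable M (\<lambda>x. (norm (g x))\<^sup>2)"
  shows "integrable M (\<lambda>x. (norm (h x))\<^sup>2)"
proof (rule Bochner_Integration.integrable_bound)
  show "integrable M (\<lambda>x. c\<^sup>2 * (norm (g x))\<^sup>2)" using sq by simp
  show "AE x in M. norm ((norm (h x))\<^sup>2) \<le> norm (c\<^sup>2 * (norm (g x))\<^sup>2)"
    using power_mono[OF le norm_ge_zero, where n = 2] by (auto simp: power_mult_distrib)
qed measurable

lemma integrable_norm_add_square:
  fixes f g :: "'a \<Rightarrow> 'b::{second_countable_topology,real_inner}"
  assumes [measurable]: "f \<in> borel_measurable M" "g \<in> borel_measurable M"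
    and "integrable M (\<lambda>x. (norm (f x))\<^sup>2)" "integrable M (\<lambda>x. (norm (g x))\<^sup>2)"
  shows "integrable M (\<lambda>x. (norm (f x + g x))\<^sup>2)"
proof (rule Bochner_Integration.integrable_bound)
  show "integrable M (\<lambda>x. 2 * (norm (f x))\<^sup>2 + 2 * (norm (g x))\<^sup>2)" using assms by simp
  show "AE x in M. norm ((norm (f x + g x))\<^sup>2) \<le> norm (2 * (norm (f x))\<^sup>2 + 2 * (norm (g x))\<^sup>2)"
  proof (rule AE_I2)
    fix x
    have "(norm (f x + g x))\<^sup>2 + (norm (f x - g x))\<^sup>2 = 2 * (norm (f x))\<^sup>2 + 2 * (norm (g x))\<^sup>2"
      unfolding power2_norm_eq_inner by (simp add: algebra_simps inner_commute)
    then show "norm ((norm (f x + g x))\<^sup>2) \<le> norm (2 * (norm (f x))\<^sup>2 + 2 * (norm (g x))\<^sup>2)"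
      by (smt (verit) real_norm_def zero_le_power2)
  qed
qed measurable

text \<open>Pythagoras: the mixed terms of the expanded square vanish, so the bound grows like
  \<open>card J\<close> and not like its square. This is the source of the variance
  reduction.\<close>

lemma (in prob_space) integrable_norm_sum_orthogonal:
  fixes D :: "'i \<Rightarrow> 'a \<Rightarrow> 'b::euclidean_space" and c :: real
  assumes J: "finite J" and D [measurable]: "\<And>j. j \<in> J \<Longrightarrow> D j \<in> borel_measurable M"
    and sq: "\<And>j. j \<in> J \<Longrightarrow> integrable M (\<lambda>x. (norm (D j x))\<^sup>2)"
    and le: "\<And>j. j \<in> J \<Longrightarrow> expectation (\<lambda>x. (norm (D j x))\<^sup>2) \<le> c"
    and orth: "\<And>i j. i \<in> J \<Longrightarrow> j \<in> J \<Longrightarrow> i \<noteq> j \<Longrightarrow> expectation (\<lambda>x. D i x \<bullet> D j x) = 0"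
  shows "integrable M (\<lambda>x. (norm (\<Sum>j\<in>J. D j x))\<^sup>2)"
    and "expectation (\<lambda>x. (norm (\<Sum>j\<in>J. D j x))\<^sup>2) \<le> card J * c"
proof -
  have int: "integrable M (\<lambda>x. D i x \<bullet> D j x)" if "i \<in> J" "j \<in> J" for i j
  proof (rule Bochner_Integration.integrable_bound[OF integrable_mult_L2])
    show "integrable M (\<lambda>x. (norm (D i x))\<^sup>2)" "integrable M (\<lambda>x. (norm (D j x))\<^sup>2)"
      using sq that by auto
    show "AE x in M. norm (D i x \<bullet> D j x) \<le> norm (norm (D i x) * norm (D j x))"
      using Cauchy_Schwarz_ineq2 by (auto simp: abs_mult)
  qed (use that in measurable)
  have eq: "(norm (\<Sum>j\<in>J. D j x))\<^sup>2 = (\<Sum>i\<in>J. \<Sum>j\<in>J. D i x \<bullet> D j x)" for x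
    unfolding power2_norm_eq_inner by (subst inner_sum_left) (simp add: inner_sum_right)
  show "integrable M (\<lambda>x. (norm (\<Sum>j\<in>J. D j x))\<^sup>2)"
    unfolding eq using int by auto
  have "expectation (\<lambda>x. (norm (\<Sum>j\<in>J. D j x))\<^sup>2) = (\<Sum>i\<in>J. \<Sum>j\<in>J. expectation (\<lambda>x. D i x \<bullet> D j x))"
    unfolding eq using int by (simp add: Bochner_Integration.integral_sum)
  also have "\<dots> = (\<Sum>i\<in>J. \<Sum>j\<in>J. if j = i then expectation (\<lambda>x. (norm (D i x))\<^sup>2) else 0)"
    using orth by (intro sum.cong refl) (auto simp: power2_norm_eq_inner)
  also have "\<dots> = (\<Sum>i\<in>J. expectation (\<lambda>x. (norm (D i x))\<^sup>2))"
    using J by simp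
  also have "\<dots> \<le> card J * c" using sum_bounded_above[OF le, of J "\<lambda>j. j"] by simp
  finally show "expectation (\<lambda>x. (norm (\<Sum>j\<in>J. D j x))\<^sup>2) \<le> card J * c" .
qed

lemma borel_measurable_vec_nth [measurable (raw)]:
  fixes h :: "'a \<Rightarrow> real ^ 'm"
  assumes "h \<in> borel_measurable M"
  shows "(\<lambda>x. h x $ b) \<in> borel_measurable M"
  using assms by (simp add: cart_eq_inner_axis)

text \<open>Unbiasedness given \<open>G\<close> makes the error integrate to zero over every event
  that \<open>X\<close> determines, which together with independence makes the errors of distinct
  samples orthogonal. Square integrability of the errors is not assumed but follows from
  \<open>variance\<close>, since \<open>nn_cond_exp\<close> is meaningful for every nonnegative
  measurable function.\<close>

lemma (in prob_space) minibatch_error: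
  fixes X :: "'a \<Rightarrow> real ^ 'm" and Z :: "'i \<Rightarrow> 'a \<Rightarrow> 'y" and \<Phi> :: "real ^ 'm \<Rightarrow> 'y \<Rightarrow> real ^ 'm"
    and \<nu> :: real
  assumes G: "subalgebra M G" and XG: "X \<in> borel_measurable G" and J: "finite J"
    and Z: "\<And>j. j \<in> J \<Longrightarrow> Z j \<in> measurable M T"
    and \<Phi> [measurable]: "(\<lambda>p. \<Phi> (fst p) (snd p)) \<in> borel_measurable (borel \<Otimes>\<^sub>M T)"
    and g [measurable]: "g \<in> borel_measurable borel"
    and dXZ: "\<And>j. j \<in> J \<Longrightarrow> distr M borel X \<Otimes>\<^sub>M distr M T (Z j)
      = distr M (borel \<Otimes>\<^sub>M T) (\<lambda>\<omega>. (X \<omega>, Z j \<omega>))"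
    and dZZ: "\<And>i j. i \<in> J \<Longrightarrow> j \<in> J \<Longrightarrow> i \<noteq> j \<Longrightarrow> distr M T (Z i) \<Otimes>\<^sub>M distr M T (Z j)
      = distr M (T \<Otimes>\<^sub>M T) (\<lambda>\<omega>. (Z i \<omega>, Z j \<omega>))"
    and dXZZ: "\<And>i j. i \<in> J \<Longrightarrow> j \<in> J \<Longrightarrow> i \<noteq> j \<Longrightarrow>
      distr M borel X \<Otimes>\<^sub>M distr M (T \<Otimes>\<^sub>M T) (\<lambda>\<omega>. (Z i \<omega>, Z j \<omega>))
      = distr M (borel \<Otimes>\<^sub>M (T \<Otimes>\<^sub>M T)) (\<lambda>\<omega>. (X \<omega>, Z i \<omega>, Z j \<omega>))"
    and sqg: "integrable M (\<lambda>\<omega>. (norm (g (X \<omega>)))\<^sup>2)"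
    and unbiased: "\<And>j. j \<in> J \<Longrightarrow>
      AE \<omega> in M. vec_cond_exp M G (\<lambda>\<omega>'. \<Phi> (X \<omega>') (Z j \<omega>')) \<omega> = g (X \<omega>)"
    and variance: "\<And>j. j \<in> J \<Longrightarrow> AE \<omega> in M. nn_cond_exp M G
      (\<lambda>\<omega>'. ennreal ((norm (\<Phi> (X \<omega>') (Z j \<omega>') - g (X \<omega>')))\<^sup>2)) \<omega> \<le> ennreal (\<nu>\<^sup>2)"
  shows "integrable M (\<lambda>\<omega>. (norm (\<Sum>j\<in>J. \<Phi> (X \<omega>) (Z j \<omega>) - g (X \<omega>)))\<^sup>2)"
    and "expectation (\<lambda>\<omega>. (norm (\<Sum>j\<in>J. \<Phi> (X \<omega>) (Z j \<omega>) - g (X \<omega>)))\<^sup>2) \<le> card J * \<nu>\<^sup>2"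
proof -
  interpret G: sigma_finite_subalgebra M G
    by (rule finite_measure_subalgebra_is_sigma_finite)
       (simp add: finite_measure_subalgebra_def finite_measure_subalgebra_axioms_def G finite_measure_axioms)
  have X [measurable]: "X \<in> borel_measurable M" by (rule measurable_from_subalg[OF G XG])
  define D where "D j \<omega> = \<Phi> (X \<omega>) (Z j \<omega>) - g (X \<omega>)" for j \<omega>
  have \<Phi>m: "(\<lambda>\<omega>. \<Phi> (X \<omega>) (Z j \<omega>)) \<in> borel_measurable M" if "j \<in> J" for j
    using measurable_compose[OF _ \<Phi>, of "\<lambda>\<omega>. (X \<omega>, Z j \<omega>)" M] Z[OF that] by simp
  have Dm: "D j \<in> borel_measurable M" if "j \<in> J" for j
    using \<Phi>m[OF that] unfolding D_def[abs_def] by simp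
  \<comment> \<open>Integrating the conditional bound removes the conditioning; finiteness of the
    result then yields \<open>Dsq\<close>.\<close>
  have nn: "(\<integral>\<^sup>+\<omega>. ennreal ((norm (D j \<omega>))\<^sup>2) \<partial>M) \<le> ennreal (\<nu>\<^sup>2)" if j: "j \<in> J" for j
  proof -
    have "(\<integral>\<^sup>+\<omega>. ennreal ((norm (D j \<omega>))\<^sup>2) \<partial>M)
        = (\<integral>\<^sup>+\<omega>. nn_cond_exp M G (\<lambda>\<omega>'. ennreal ((norm (D j \<omega>'))\<^sup>2)) \<omega> \<partial>M)"
      using G.nn_cond_exp_intg[of "\<lambda>_. 1" "\<lambda>\<omega>'. ennreal ((norm (D j \<omega>'))\<^sup>2)"] Dm[OF j] by simp
    also have "\<dots> \<le> (\<integral>\<^sup>+\<omega>. ennreal (\<nu>\<^sup>2) \<partial>M)"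
      using variance[OF j] by (intro nn_integral_mono_AE) (simp add: D_def)
    also have "\<dots> = ennreal (\<nu>\<^sup>2)" by (simp add: emeasure_space_1)
    finally show ?thesis .
  qed
  have Dsq: "integrable M (\<lambda>\<omega>. (norm (D j \<omega>))\<^sup>2)" if j: "j \<in> J" for j
    using nn[OF j] Dm[OF j] by (intro integrableI_bounded) (auto simp: le_less_trans[OF _ ennreal_less_top])
  have Dle: "expectation (\<lambda>\<omega>. (norm (D j \<omega>))\<^sup>2) \<le> \<nu>\<^sup>2" if j: "j \<in> J" for j
    using nn[OF j] nn_integral_eq_integral[OF Dsq[OF j]] by (simp add: ennreal_le_iff)
  have comp_sq: "integrable M (\<lambda>\<omega>. (h \<omega> $ b)\<^sup>2)"
    if "h \<in> borel_measurable M" "integrable M (\<lambda>\<omega>. (norm (h \<omega>))\<^sup>2)" for h :: "'a \<Rightarrow> real ^ 'm" and b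
  proof (rule Bochner_Integration.integrable_bound[OF that(2)])
    show "(\<lambda>\<omega>. (h \<omega> $ b)\<^sup>2) \<in> borel_measurable M" using that(1) by measurable
    show "AE \<omega> in M. norm ((h \<omega> $ b)\<^sup>2) \<le> norm ((norm (h \<omega>))\<^sup>2)"
      using component_le_norm_cart by (auto simp: abs_le_square_iff[symmetric])
  qed
  have gX: "(\<lambda>\<omega>. g (X \<omega>)) \<in> borel_measurable M" by measurable
  have g_int: "integrable M (\<lambda>\<omega>. g (X \<omega>) $ b)" for b
    by (rule square_integrable_imp_integrable[OF borel_measurable_vec_nth[OF gX] comp_sq[OF gX sqg]])
  have D_int: "integrable M (\<lambda>\<omega>. D j \<omega> $ b)" if "j \<in> J" for j b
    by (rule square_integrable_imp_integrable[OF borel_measurable_vec_nth[OF Dm] comp_sq[OF Dm Dsq]]) (rule that)+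
  \<comment> \<open>without this integrability, \<open>unbiased\<close> would only speak about junk values of \<open>real_cond_exp\<close>\<close>
  have \<Phi>_int: "integrable M (\<lambda>\<omega>. \<Phi> (X \<omega>) (Z j \<omega>) $ b)" if "j \<in> J" for j b
    using Bochner_Integration.integrable_add[OF D_int[OF that, of b] g_int[of b]] by (simp add: D_def)
  have zero: "expectation (\<lambda>\<omega>. indicator A (X \<omega>) * (\<Phi> (X \<omega>) (Z j \<omega>) - g (X \<omega>)) $ b) = 0"
    if j: "j \<in> J" and A: "A \<in> sets borel" for j b A
  proof -
    define A' where "A' = X -` A \<inter> space M"
    have A': "A' \<in> sets G"
      using measurable_sets[OF XG A] G by (simp add: A'_def subalgebra_def)
    have A'M [measurable]: "A' \<in> sets M" using A' G by (auto simp: subalgebra_def)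
    have "AE \<omega> in M. real_cond_exp M G (\<lambda>\<omega>'. \<Phi> (X \<omega>') (Z j \<omega>') $ b) \<omega> = g (X \<omega>) $ b"
      using unbiased[OF j] by eventually_elim (auto simp: vec_cond_exp_def vec_eq_iff)
    then have "(\<integral>\<omega>\<in>A'. \<Phi> (X \<omega>) (Z j \<omega>) $ b \<partial>M) = (\<integral>\<omega>\<in>A'. g (X \<omega>) $ b \<partial>M)"
      unfolding G.real_cond_exp_intA[OF \<Phi>_int[OF j] A']
      using gX by (intro set_lebesgue_integral_cong_AE) (auto intro: borel_measurable_cond_exp2)
    moreover have "set_integrable M A' (\<lambda>\<omega>. \<Phi> (X \<omega>) (Z j \<omega>) $ b)"
        "set_integrable M A' (\<lambda>\<omega>. g (X \<omega>) $ b)"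
      unfolding set_integrable_def
      by (intro integrable_mult_indicator A'M \<Phi>_int[OF j] g_int)+
    ultimately have "(\<integral>\<omega>\<in>A'. \<Phi> (X \<omega>) (Z j \<omega>) $ b - g (X \<omega>) $ b \<partial>M) = 0"
      by (simp add: set_integral_diff)
    moreover have "expectation (\<lambda>\<omega>. indicator A (X \<omega>) * (\<Phi> (X \<omega>) (Z j \<omega>) - g (X \<omega>)) $ b)
        = (\<integral>\<omega>\<in>A'. \<Phi> (X \<omega>) (Z j \<omega>) $ b - g (X \<omega>) $ b \<partial>M)"
      unfolding set_lebesgue_integral_def
      by (intro Bochner_Integration.integral_cong) (auto simp: A'_def split: split_indicator)
    ultimately show ?thesis by simp
  qed
  have orth: "expectation (\<lambda>\<omega>. D i \<omega> \<bullet> D j \<omega>) = 0" if ij: "i \<in> J" "j \<in> J" "i \<noteq> j" for i j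
  proof -
    have comp: "expectation (\<lambda>\<omega>. D i \<omega> $ b * D j \<omega> $ b) = 0" for b
      unfolding D_def
    proof (rule indep_copies_orthogonal[where S = borel and T = T and X = X and Y = "Z i" and Z = "Z j"
          and \<phi> = "\<lambda>u z. (\<Phi> u z - g u) $ b"])
      show "(\<lambda>p. (\<Phi> (fst p) (snd p) - g (fst p)) $ b) \<in> borel_measurable (borel \<Otimes>\<^sub>M T)" by measurable
      show "integrable M (\<lambda>\<omega>. ((\<Phi> (X \<omega>) (Z i \<omega>) - g (X \<omega>)) $ b)\<^sup>2)"
        "integrable M (\<lambda>\<omega>. ((\<Phi> (X \<omega>) (Z j \<omega>) - g (X \<omega>)) $ b)\<^sup>2)"
        using comp_sq[OF Dm Dsq] ij by (auto simp: D_def)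
      show "expectation (\<lambda>\<omega>. indicator A (X \<omega>) * (\<Phi> (X \<omega>) (Z j \<omega>) - g (X \<omega>)) $ b) = 0"
        if "A \<in> sets borel" for A
        by (rule zero[OF ij(2) that])
    qed (use ij in \<open>auto intro: dXZ dZZ dXZZ Z X\<close>)
    have "expectation (\<lambda>\<omega>. D i \<omega> \<bullet> D j \<omega>) = (\<Sum>b\<in>UNIV. expectation (\<lambda>\<omega>. D i \<omega> $ b * D j \<omega> $ b))"
      unfolding inner_vec_def inner_real_def
      using ij by (intro Bochner_Integration.integral_sum integrable_mult_L2 comp_sq Dm Dsq
          borel_measurable_vec_nth) auto
    then show ?thesis by (simp add: comp)
  qed
  show "integrable M (\<lambda>\<omega>. (norm (\<Sum>j\<in>J. \<Phi> (X \<omega>) (Z j \<omega>) - g (X \<omega>)))\<^sup>2)"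
    "expectation (\<lambda>\<omega>. (norm (\<Sum>j\<in>J. \<Phi> (X \<omega>) (Z j \<omega>) - g (X \<omega>)))\<^sup>2) \<le> card J * \<nu>\<^sup>2"
    using integrable_norm_sum_orthogonal[of J D "\<nu>\<^sup>2", OF J Dm Dsq Dle orth]
    by (auto simp: D_def)
qed

section \<open>The sigma-algebra of the past\<close>

lemma history_eq_generated:
  "sets (history M x0 N Y k) = sets (sigma (space M)
    (\<Union>i\<in>{(j, t). 1 \<le> j \<and> j \<le> N t \<and> t < k}. {(case i of (j, t) \<Rightarrow> Y j t) -` C \<inter> space M | C. C \<in> sets borel}))"
  (is "_ = sets (sigma _ ?U)")
proof -
  let ?G = "{(\<lambda>_. x0) -` A \<inter> space M | A. A \<in> sets borel} \<union>
      {Y j t -` A \<inter> space M | j t A. 1 \<le> j \<and> j \<le> N t \<and> t < k \<and> A \<in> sets borel}"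
  have "sigma_sets (space M) ?G = sigma_sets (space M) ?U"
  proof (rule sigma_sets_eqI)
    fix a assume "a \<in> ?G"
    then consider A where "a = (\<lambda>_. x0) -` A \<inter> space M"
      | j t A where "a = Y j t -` A \<inter> space M" "1 \<le> j" "j \<le> N t" "t < k" "A \<in> sets borel"
      by auto
    then show "a \<in> sigma_sets (space M) ?U"
    proof cases
      case 1
      \<comment> \<open>The initial point is constant and adds only trivial events. Hence the
        samples alone generate the history, which is the form
        \<open>joint_distr_indep_generated\<close> expects.\<close>
      then have "a = {} \<or> a = space M" by (cases "x0 \<in> A") auto
      then show ?thesis by (auto intro: sigma_sets.Empty sigma_sets_top)
    next
      case 2
      then have "a \<in> ?U" by (intro UN_I[of "(j, t)"]) auto
      then show ?thesis by (rule sigma_sets.Basic)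
    qed
  qed (auto intro!: sigma_sets.Basic)
  then show ?thesis
    unfolding history_def by (subst (1 2) sets_measure_of) auto
qed

lemma space_history [simp]: "space (history M x0 N Y k) = space M"
  unfolding history_def by (subst space_measure_of) auto

lemma subalgebra_history_mono:
  assumes "s \<le> k"
  shows "subalgebra (history M x0 N Y k) (history M x0 N Y s)"
  unfolding subalgebra_def
proof
  have "{(\<lambda>_. x0) -` A \<inter> space M | A. A \<in> sets borel} \<union>
      {Y j t -` A \<inter> space M | j t A. 1 \<le> j \<and> j \<le> N t \<and> t < s \<and> A \<in> sets borel}
    \<subseteq> {(\<lambda>_. x0) -` A \<inter> space M | A. A \<in> sets borel} \<union>
      {Y j t -` A \<inter> space M | j t A. 1 \<le> j \<and> j \<le> N t \<and> t < k \<and> A \<in> sets borel}"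
    using order_less_le_trans[OF _ assms] by blast
  from sigma_sets_subseteq[OF this, of "space M"]
  show "sets (history M x0 N Y s) \<subseteq> sets (history M x0 N Y k)"
    unfolding history_def by (subst (1 2) sets_measure_of) auto
qed simp

lemma measurable_history:
  fixes Y :: "nat \<Rightarrow> nat \<Rightarrow> 'w \<Rightarrow> real ^ 'd"
  assumes "1 \<le> j" "j \<le> N t" "t < k"
  shows "Y j t \<in> borel_measurable (history M x0 N Y k)"
proof (rule measurableI)
  fix A :: "(real ^ 'd) set" assume "A \<in> sets borel"
  then show "Y j t -` A \<inter> space (history M x0 N Y k) \<in> sets (history M x0 N Y k)"
    unfolding space_history unfolding history_def using assms
    by (subst sets_measure_of) (auto intro!: sigma_sets.Basic)
qed simp

lemma integrable_energy:
  fixes a b :: "'w \<Rightarrow> 'a::euclidean_space"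
  assumes T: "linear T" "\<And>z. norm (T z) \<le> c * norm z"
    and [measurable]: "a \<in> borel_measurable M" "b \<in> borel_measurable M"
    and sq: "integrable M (\<lambda>\<omega>. (norm (a \<omega>))\<^sup>2)" "integrable M (\<lambda>\<omega>. (norm (b \<omega>))\<^sup>2)"
  shows "integrable M (\<lambda>\<omega>. energy T r (a \<omega>) (b \<omega>))"
proof -
  have [measurable]: "T \<in> borel_measurable borel"
    using T(1) by (intro borel_measurable_continuous_onI linear_continuous_on linear_linear[THEN iffD2])
  have "integrable M (\<lambda>\<omega>. norm (T (a \<omega>)) * norm (b \<omega>))"
  proof (rule integrable_mult_L2)
    show "integrable M (\<lambda>\<omega>. (norm (T (a \<omega>)))\<^sup>2)"
      by (rule integrable_norm_square_bound[OF _ T(2) sq(1)]) measurable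
  qed (use sq in measurable)
  then have "integrable M (\<lambda>\<omega>. T (a \<omega>) \<bullet> b \<omega>)"
    by (rule Bochner_Integration.integrable_bound) (use Cauchy_Schwarz_ineq2 in \<open>auto simp: abs_mult\<close>)
  then show ?thesis unfolding energy_def using sq by simp
qed

text \<open>Integrability is part of the conclusion because the Bochner integral of a non-integrable
  function is 0, which would make the bound hold for no reason.\<close>

theorem proposition7:
  fixes M :: "'w measure"
    and \<xi> :: "'w \<Rightarrow> real ^ 'd"
    and Y :: "nat \<Rightarrow> nat \<Rightarrow> 'w \<Rightarrow> real ^ 'd"
    and F :: "real ^ 'm \<Rightarrow> real ^ 'd \<Rightarrow> real"
    and f :: "real ^ 'm \<Rightarrow> real"
    and H :: "real ^ 'm ^ 'm"
    and L \<eta> \<nu> \<kappa> \<alpha> \<beta> v :: real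
    and N :: "nat \<Rightarrow> nat"
    and x0 xstar :: "real ^ 'm"
    and x w :: "nat \<Rightarrow> 'w \<Rightarrow> real ^ 'm"
  assumes M: "prob_space M"
    and \<xi>: "\<xi> \<in> borel_measurable M"
    and Y_indep: "prob_space.indep_vars M (\<lambda>_. borel) (\<lambda>(j, k). Y j k) {(j, k). 1 \<le> j \<and> j \<le> N k}"
    and Y_distr: "\<And>j k. 1 \<le> j \<Longrightarrow> j \<le> N k \<Longrightarrow> distr M borel (Y j k) = distr M borel \<xi>"
    and F_meas: "\<And>u. F u \<in> borel_measurable borel"
    and F_diff: "\<And>u y. (\<lambda>u'. F u' y) differentiable (at u)"
    and F_int: "\<And>u. integrable M (\<lambda>\<omega>. F u (\<xi> \<omega>))"
    and f_def: "\<And>u. f u = (\<integral>\<omega>. F u (\<xi> \<omega>) \<partial>M)"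
    and f_diff: "\<And>u. f differentiable (at u)"
    and f_C1: "continuous_on UNIV (grad f)"
    and L: "L > 0"
    and f_Lip: "\<And>u u'. norm (grad f u - grad f u') \<le> L * norm (u - u')"
    and \<eta>: "\<eta> > 0"
    and f_strong: "\<And>u u'. (grad f u - grad f u') \<bullet> (u - u') \<ge> \<eta> * (norm (u - u'))\<^sup>2"
    and \<nu>: "\<nu> > 0"
    and unbiased: "\<And>j k. 1 \<le> j \<Longrightarrow> j \<le> N k \<Longrightarrow>
      AE \<omega> in M. vec_cond_exp M (history M x0 N Y k)
        (\<lambda>\<omega>'. grad (\<lambda>u. F u (Y j k \<omega>')) (x k \<omega>')) \<omega> = grad f (x k \<omega>)"
    and variance: "\<And>j k. 1 \<le> j \<Longrightarrow> j \<le> N k \<Longrightarrow>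
      AE \<omega> in M. nn_cond_exp M (history M x0 N Y k)
        (\<lambda>\<omega>'. ennreal ((norm (grad (\<lambda>u. F u (Y j k \<omega>')) (x k \<omega>') - grad f (x k \<omega>')))\<^sup>2)) \<omega>
          \<le> ennreal (\<nu>\<^sup>2)"
    and xstar: "is_arg_min f (\<lambda>_. True) xstar"
    and f_quadratic: "quadratic_fun f"
    and hessian: "\<And>u. (grad f has_derivative (\<lambda>h. H *v h)) (at u)"
    and \<kappa>: "\<kappa> = L / \<eta>"
    and \<alpha>: "\<alpha> = 4 / (sqrt \<eta> + sqrt L)\<^sup>2"
    and \<beta>: "\<beta> = ((sqrt \<kappa> - 1) / (sqrt \<kappa> + 1))\<^sup>2"
    and v: "v > 0"
    and N: "\<And>k. N k = nat \<lceil>(real k + 1) powr v\<rceil>"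
    and w: "\<And>k \<omega>. w k \<omega> =
      (1 / real (N k)) *\<^sub>R (\<Sum>j = 1..N k. grad (\<lambda>u. F u (Y j k \<omega>)) (x k \<omega>)) - grad f (x k \<omega>)"
    and x_init: "\<And>\<omega>. x 0 \<omega> = x0"
    \<comment> \<open>the first step uses the convention that the iterate of index \<open>-1\<close> is \<open>x0\<close>\<close>
    and x_step: "\<And>k \<omega>. x (Suc k) \<omega> =
      x k \<omega> - \<alpha> *\<^sub>R (grad f (x k \<omega>) + w k \<omega>)
        + \<beta> *\<^sub>R (x k \<omega> - (if k = 0 then x0 else x (k - 1) \<omega>))"
  shows "\<exists>C > 0. \<forall>k.
    integrable M (\<lambda>\<omega>. (norm (x (Suc k) \<omega> - xstar, x k \<omega> - xstar))\<^sup>2) \<and>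
    (\<integral>\<omega>. (norm (x (Suc k) \<omega> - xstar, x k \<omega> - xstar))\<^sup>2 \<partial>M) \<le> C * (real k + 1) powr (- v)"
proof -
  interpret prob_space M by (rule M)

  \<comment> \<open>Measurability of samples and iterates\<close>
  define I where "I = {(j, k). 1 \<le> j \<and> j \<le> N k}"
  define Y' where "Y' = (\<lambda>(j, k). Y j k)"
  define G where "G k = history M x0 N Y k" for k
  define \<Phi> where "\<Phi> u y = grad (\<lambda>u. F u y) u" for u y
  have ind: "indep_vars (\<lambda>_. borel) Y' I"
    using Y_indep by (simp add: Y'_def I_def)
  have Ym: "Y j k \<in> borel_measurable M" if "1 \<le> j" "j \<le> N k" for j k
    using ind that unfolding indep_vars_def2 by (force simp: Y'_def I_def)
  have subG: "subalgebra M (G k)" for k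
    unfolding G_def by (rule subalgebra_history) (rule Ym)
  have \<Phi>m [measurable]: "(\<lambda>p. \<Phi> (fst p) (snd p)) \<in> borel_measurable (borel \<Otimes>\<^sub>M borel)"
    unfolding \<Phi>_def by (rule borel_measurable_grad[OF F_meas F_diff])
  have gm [measurable]: "grad f \<in> borel_measurable borel"
    by (rule borel_measurable_continuous_onI[OF f_C1])
  have w': "w k \<omega> = (1 / real (N k)) *\<^sub>R (\<Sum>j = 1..N k. \<Phi> (x k \<omega>) (Y j k \<omega>)) - grad f (x k \<omega>)" for k \<omega>
    by (simp add: w \<Phi>_def)
  \<comment> \<open>Strong induction, since a step looks back two iterates. The batch used to form
    iterate \<open>Suc i\<close> has index \<open>i\<close>, so it belongs to the history at
    \<open>Suc i\<close>.\<close>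
  have xG: "x k \<in> borel_measurable (G k)" for k
  proof (induction k rule: less_induct)
    case (less k)
    show ?case
    proof (cases k)
      case 0
      then show ?thesis by (simp add: x_init cong: measurable_cong)
    next
      case (Suc i)
      have up: "x s \<in> borel_measurable (G k)" if "s < k" for s
        using measurable_from_subalg[OF subalgebra_history_mono[OF less_imp_le[OF that]] less[OF that, unfolded G_def]]
        by (simp add: G_def)
      have [measurable]: "x i \<in> borel_measurable (G k)" by (rule up) (simp add: Suc)
      have [measurable]: "(\<lambda>\<omega>. if i = 0 then x0 else x (i - 1) \<omega>) \<in> borel_measurable (G k)"
        using up[of "i - 1"] by (cases "i = 0") (auto simp: Suc)
      have [measurable]: "(\<lambda>\<omega>. \<Phi> (x i \<omega>) (Y j i \<omega>)) \<in> borel_measurable (G k)" if "j \<in> {1..N i}" for j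
      proof -
        have "Y j i \<in> borel_measurable (G k)"
          using that unfolding G_def by (intro measurable_history) (auto simp: Suc)
        then show ?thesis
          using measurable_compose[OF _ \<Phi>m, of "\<lambda>\<omega>. (x i \<omega>, Y j i \<omega>)" "G k"] by simp
      qed
      have "(\<lambda>\<omega>. x i \<omega> - \<alpha> *\<^sub>R (grad f (x i \<omega>)
          + ((1 / real (N i)) *\<^sub>R (\<Sum>j = 1..N i. \<Phi> (x i \<omega>) (Y j i \<omega>)) - grad f (x i \<omega>)))
          + \<beta> *\<^sub>R (x i \<omega> - (if i = 0 then x0 else x (i - 1) \<omega>))) \<in> borel_measurable (G k)"
        by measurable
      moreover have "x k = (\<lambda>\<omega>. x i \<omega> - \<alpha> *\<^sub>R (grad f (x i \<omega>)
          + ((1 / real (N i)) *\<^sub>R (\<Sum>j = 1..N i. \<Phi> (x i \<omega>) (Y j i \<omega>)) - grad f (x i \<omega>)))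
          + \<beta> *\<^sub>R (x i \<omega> - (if i = 0 then x0 else x (i - 1) \<omega>)))"
        unfolding Suc by (rule ext) (simp only: x_step w')
      ultimately show ?thesis by simp
    qed
  qed
  have xm [measurable]: "x k \<in> borel_measurable M" for k
    by (rule measurable_from_subalg[OF subG xG])

  \<comment> \<open>Bounds on the Hessian and on the map \<open>T\<close>\<close>
  note H = quadratic_hessian_selfadjoint[OF f_quadratic hessian]
  have "grad f xstar = 0"
  proof -
    have "(\<lambda>h. h \<bullet> grad f xstar) = (\<lambda>h. 0)"
    proof (rule differential_zero_maxmin)
      show "(f has_derivative (\<lambda>h. h \<bullet> grad f xstar)) (at xstar)"
        using GDERIV_grad[OF f_diff] by (simp add: gderiv_def)
      show "(\<forall>y\<in>UNIV. f y \<le> f xstar) \<or> (\<forall>y\<in>UNIV. f xstar \<le> f y)"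
        using xstar by (auto simp: is_arg_min_def not_less)
    qed auto
    then have "grad f xstar \<bullet> grad f xstar = 0" by (rule fun_cong)
    then show ?thesis by simp
  qed
  with H(2)[of _ xstar] have gH: "grad f u = H *v (u - xstar)" for u by simp
  have Hl: "norm (H *v u) \<le> L * norm u" for u
    using f_Lip[of "u + xstar" xstar] by (simp add: H(2))
  have Hs: "\<eta> * (norm u)\<^sup>2 \<le> (H *v u) \<bullet> u" for u
    using f_strong[of xstar "u + xstar"] f_strong[of "u + xstar" xstar] by (simp add: H(2))
  have Hu: "(H *v u) \<bullet> u \<le> L * (norm u)\<^sup>2" for u
  proof -
    have "(H *v u) \<bullet> u \<le> norm (H *v u) * norm u" by (rule norm_cauchy_schwarz)
    also have "\<dots> \<le> L * norm u * norm u" by (intro mult_right_mono Hl) simp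
    finally show ?thesis by (simp add: power2_eq_square)
  qed
  \<comment> \<open>Any nonzero vector compares the two bounds on the quadratic form; a unit
    coordinate vector with an arbitrary index is taken.\<close>
  have "\<eta> \<le> L"
    using order_trans[OF Hs Hu, of "axis undefined 1"] by simp
  define r where "r = (sqrt L - sqrt \<eta>) / (sqrt L + sqrt \<eta>)"
  note r = heavy_ball_parameters[OF \<eta> \<open>\<eta> \<le> L\<close> \<kappa> \<alpha> \<beta>, folded r_def]
  define T where "T a = (1 + \<beta>) *\<^sub>R a - \<alpha> *\<^sub>R (H *v a)" for a :: "real ^ 'm"
  have T_lin: "linear T"
    unfolding T_def
    by (intro linearI) (auto simp: algebra_simps matrix_vector_right_distrib matrix_vector_mult_scaleR)
  have [measurable]: "T \<in> borel_measurable borel"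
    using T_lin by (intro borel_measurable_continuous_onI linear_continuous_on linear_linear[THEN iffD2])
  have T_sa: "T a \<bullet> b = a \<bullet> T b" for a b
    by (simp add: T_def inner_diff_left inner_diff_right H(1))
  have T_quad: "\<bar>T a \<bullet> a\<bar> \<le> 2 * r * (norm a)\<^sup>2" for a
  proof -
    have e: "T a \<bullet> a = (1 + r\<^sup>2) * (norm a)\<^sup>2 - \<alpha> * ((H *v a) \<bullet> a)"
      by (simp add: T_def inner_diff_left power2_norm_eq_inner r(3))
    have "(1 - r)\<^sup>2 * (norm a)\<^sup>2 \<le> \<alpha> * ((H *v a) \<bullet> a)"
      using mult_left_mono[OF Hs, of \<alpha> a] r(4) by (simp add: r(5)[symmetric])
    moreover have "\<alpha> * ((H *v a) \<bullet> a) \<le> (1 + r)\<^sup>2 * (norm a)\<^sup>2"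
      using mult_left_mono[OF Hu, of \<alpha> a] r(4) by (simp add: r(6)[symmetric])
    ultimately show ?thesis unfolding e by (simp add: abs_le_iff power2_eq_square algebra_simps)
  qed
  have T_norm: "norm (T a) \<le> 2 * r * norm a" for a
    by (rule bounded_selfadjoint_norm_le[OF T_lin T_sa T_quad])

  \<comment> \<open>The error recursion\<close>
  define e where "e k \<omega> = x k \<omega> - xstar" for k \<omega>
  \<comment> \<open>This is the error one step earlier; the convention for index -1 gives
    \<open>ep 0 = e 0\<close>.\<close>
  define ep where "ep k \<omega> = (if k = 0 then x0 else x (k - 1) \<omega>) - xstar" for k \<omega>
  have e_step: "e (Suc k) \<omega> = T (e k \<omega>) - r\<^sup>2 *\<^sub>R ep k \<omega> + (- \<alpha>) *\<^sub>R w k \<omega>" for k \<omega>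
    unfolding e_def ep_def x_step gH T_def r(3)[symmetric] by (simp add: algebra_simps)
  have ep_Suc: "ep (Suc k) = e k" for k by (simp add: ep_def e_def fun_eq_iff)
  have em [measurable]: "e k \<in> borel_measurable M" for k unfolding e_def[abs_def] by measurable
  have epm [measurable]: "ep k \<in> borel_measurable M" for k
    by (cases k) (auto simp: ep_Suc ep_def[abs_def])
  \<comment> \<open>Because \<open>\<alpha> > 0\<close>, the noise can be solved for in the
    recursion and inherits measurability from the errors.\<close>
  have wm [measurable]: "w k \<in> borel_measurable M" for k
  proof -
    have "w k = (\<lambda>\<omega>. (1 / \<alpha>) *\<^sub>R (T (e k \<omega>) - r\<^sup>2 *\<^sub>R ep k \<omega> - e (Suc k) \<omega>))"
      using r(4) by (simp add: e_step fun_eq_iff)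
    then show ?thesis by simp
  qed
  have N_ge: "(real k + 1) powr v \<le> N k" for k
    unfolding N by linarith
  have N_pos: "0 < N k" for k
    using N_ge[of k] powr_gt_zero[of "real k + 1" v] by linarith

  \<comment> \<open>Second moment of the batch noise\<close>
  have w_bound: "integrable M (\<lambda>\<omega>. (norm (w k \<omega>))\<^sup>2) \<and>
      expectation (\<lambda>\<omega>. (norm (w k \<omega>))\<^sup>2) \<le> \<nu>\<^sup>2 * (real k + 1) powr (- v)"
    if sq: "integrable M (\<lambda>\<omega>. (norm (e k \<omega>))\<^sup>2)" for k
  proof -
    define J where "J = {1..N k}"
    define S where "S \<omega> = (\<Sum>j\<in>J. \<Phi> (x k \<omega>) (Y j k \<omega>) - grad f (x k \<omega>))" for \<omega>
    define E where "E i = {Y' i -` C \<inter> space M | C. C \<in> sets borel}" for i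
    \<comment> \<open>These index the samples before time \<open>k\<close>. The current batch has
      second index exactly \<open>k\<close>, so past and batch are disjoint groups.\<close>
    define A where "A = {(j, t). 1 \<le> j \<and> j \<le> N t \<and> t < k}"
    have gen: "Y j k \<in> borel_measurable (sigma (space M) (\<Union>i\<in>B. E i))" if "(j, k) \<in> B" for B j
    proof (rule measurableI)
      fix C :: "(real ^ 'd) set" assume "C \<in> sets borel"
      then have "Y j k -` C \<inter> space M \<in> (\<Union>i\<in>B. E i)"
        using that by (intro UN_I[of "(j, k)"]) (auto simp: E_def Y'_def)
      moreover have "(\<Union>i\<in>B. E i) \<subseteq> Pow (space M)" by (auto simp: E_def)
      ultimately show "Y j k -` C \<inter> space (sigma (space M) (\<Union>i\<in>B. E i)) \<in> sets (sigma (space M) (\<Union>i\<in>B. E i))"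
        by simp
    qed simp
    have xA: "x k \<in> borel_measurable (sigma (space M) (\<Union>i\<in>A. E i))"
    proof -
      have "sets (G k) = sets (sigma (space M) (\<Union>i\<in>A. E i))"
        unfolding G_def A_def E_def Y'_def by (rule history_eq_generated)
      from measurable_cong_sets[OF this refl] xG show ?thesis by auto
    qed
    have AI: "A \<subseteq> I" "(j, k) \<notin> A" for j by (auto simp: A_def I_def)
    have JI: "j \<in> J \<Longrightarrow> (j, k) \<in> I" for j by (auto simp: J_def I_def)
    note joint = joint_distr_indep_generated[OF ind, folded E_def]
    have dXZ: "distr M borel (x k) \<Otimes>\<^sub>M distr M borel (Y j k) = distr M (borel \<Otimes>\<^sub>M borel) (\<lambda>\<omega>. (x k \<omega>, Y j k \<omega>))"
      if "j \<in> J" for j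
      by (rule joint[OF _ _ _ xA gen[of _ "{(j, k)}"]]) (use AI JI that in auto)
    have dZZ: "distr M borel (Y i k) \<Otimes>\<^sub>M distr M borel (Y j k) = distr M (borel \<Otimes>\<^sub>M borel) (\<lambda>\<omega>. (Y i k \<omega>, Y j k \<omega>))"
      if "i \<in> J" "j \<in> J" "i \<noteq> j" for i j
      by (rule joint[OF _ _ _ gen[of _ "{(i, k)}"] gen[of _ "{(j, k)}"]]) (use JI that in auto)
    have dXZZ: "distr M borel (x k) \<Otimes>\<^sub>M distr M (borel \<Otimes>\<^sub>M borel) (\<lambda>\<omega>. (Y i k \<omega>, Y j k \<omega>))
        = distr M (borel \<Otimes>\<^sub>M (borel \<Otimes>\<^sub>M borel)) (\<lambda>\<omega>. (x k \<omega>, Y i k \<omega>, Y j k \<omega>))"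
      if "i \<in> J" "j \<in> J" "i \<noteq> j" for i j
      by (rule joint[OF _ _ _ xA measurable_Pair[OF gen[of _ "{(i, k), (j, k)}"] gen[of _ "{(i, k), (j, k)}"]]])
         (use AI JI that in auto)
    \<comment> \<open>Here the premise \<open>sq\<close> enters: the gradient at the iterate is a
      linear image of the error.\<close>
    have sqg: "integrable M (\<lambda>\<omega>. (norm (grad f (x k \<omega>)))\<^sup>2)"
    proof (rule integrable_norm_square_bound[OF _ _ sq])
      show "norm (grad f (x k \<omega>)) \<le> L * norm (e k \<omega>)" for \<omega> unfolding gH e_def by (rule Hl)
    qed measurable
    have unb: "AE \<omega> in M. vec_cond_exp M (G k) (\<lambda>\<omega>'. \<Phi> (x k \<omega>') (Y j k \<omega>')) \<omega> = grad f (x k \<omega>)"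
      if "j \<in> J" for j
      using unbiased[of j k] that by (simp add: G_def \<Phi>_def J_def)
    have var: "AE \<omega> in M. nn_cond_exp M (G k) (\<lambda>\<omega>'. ennreal ((norm (\<Phi> (x k \<omega>') (Y j k \<omega>') - grad f (x k \<omega>')))\<^sup>2)) \<omega>
        \<le> ennreal (\<nu>\<^sup>2)" if "j \<in> J" for j
      using variance[of j k] that by (simp add: G_def \<Phi>_def J_def)
    have *: "integrable M (\<lambda>\<omega>. (norm (S \<omega>))\<^sup>2)"
        "expectation (\<lambda>\<omega>. (norm (S \<omega>))\<^sup>2) \<le> card J * \<nu>\<^sup>2"
      unfolding S_def
      using minibatch_error[where G = "G k" and T = borel and X = "x k" and Z = "\<lambda>j. Y j k" and J = J
          and \<Phi> = \<Phi> and g = "grad f" and \<nu> = \<nu>, OF subG xG _ _ \<Phi>m gm dXZ dZZ dXZZ sqg unb var] Ym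
      by (auto simp: J_def)
    have wS: "w k \<omega> = (1 / real (N k)) *\<^sub>R S \<omega>" for \<omega>
      using N_pos[of k]
      by (simp add: w' S_def J_def sum_subtractf scaleR_right_diff_distrib sum_constant_scaleR del: sum_constant)
    have n: "(norm (w k \<omega>))\<^sup>2 = (norm (S \<omega>))\<^sup>2 / (real (N k))\<^sup>2" for \<omega>
      by (simp add: wS power_divide)
    have "expectation (\<lambda>\<omega>. (norm (w k \<omega>))\<^sup>2) \<le> real (card J) * \<nu>\<^sup>2 / (real (N k))\<^sup>2"
      unfolding n using * by (simp add: divide_right_mono)
    also have "\<dots> = \<nu>\<^sup>2 / N k" using N_pos[of k] by (simp add: J_def power2_eq_square)
    also have "\<dots> \<le> \<nu>\<^sup>2 / (real k + 1) powr v"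
      using N_ge[of k] by (intro divide_left_mono) (auto intro!: mult_pos_pos N_pos)
    also have "\<dots> = \<nu>\<^sup>2 * (real k + 1) powr (- v)" by (simp add: powr_minus divide_inverse)
    finally show ?thesis unfolding n using * by simp
  qed

  \<comment> \<open>Square integrability of all errors\<close>
  have e_sq: "integrable M (\<lambda>\<omega>. (norm (e k \<omega>))\<^sup>2) \<and> integrable M (\<lambda>\<omega>. (norm (ep k \<omega>))\<^sup>2)" for k
  proof (induction k)
    case 0
    show ?case by (simp add: e_def ep_def x_init)
  next
    case (Suc k)
    have 1: "integrable M (\<lambda>\<omega>. (norm (T (e k \<omega>)))\<^sup>2)"
      by (rule integrable_norm_square_bound[where g = "e k" and c = "2 * r"]) (use T_norm Suc in auto)
    \<comment> \<open>The induction hypothesis supplies the premise of \<open>w_bound\<close>, so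
      the noise at time \<open>k\<close> is square integrable as well.\<close>
    have 2: "integrable M (\<lambda>\<omega>. (norm ((- r\<^sup>2) *\<^sub>R ep k \<omega>))\<^sup>2)"
      "integrable M (\<lambda>\<omega>. (norm ((- \<alpha>) *\<^sub>R w k \<omega>))\<^sup>2)"
      using Suc w_bound by (auto simp: power_mult_distrib)
    have "integrable M (\<lambda>\<omega>. (norm (T (e k \<omega>) + (- r\<^sup>2) *\<^sub>R ep k \<omega> + (- \<alpha>) *\<^sub>R w k \<omega>))\<^sup>2)"
      by (intro integrable_norm_add_square 1 2) measurable
    then show ?case using Suc by (simp add: e_step ep_Suc)
  qed

  \<comment> \<open>Contraction in expectation and the decay rate\<close>
  obtain K q B D :: real where q: "0 \<le> q" "q < 1" and B: "0 \<le> B" "0 \<le> K" "0 \<le> D"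
    and dom: "\<And>a b. (norm a)\<^sup>2 + (norm b)\<^sup>2 \<le> D * (K * energy T r a b + (norm b)\<^sup>2)"
    and contr: "\<And>a b n. K * energy T r (T a - r\<^sup>2 *\<^sub>R b + n) a + (norm a)\<^sup>2
          \<le> q * (K * energy T r a b + (norm b)\<^sup>2) + B * (norm n)\<^sup>2"
    by (rule lyapunov_contraction[OF T_lin T_sa T_norm r(1,2)]) (rule that)
  define V where "V k \<omega> = K * energy T r (e k \<omega>) (ep k \<omega>) + (norm (ep k \<omega>))\<^sup>2" for k \<omega>
  have V_int: "integrable M (V k)" for k
    unfolding V_def[abs_def] using e_sq[of k]
    by (intro Bochner_Integration.integrable_add integrable_mult_right integrable_energy[OF T_lin T_norm]) auto
  have V_nonneg: "0 \<le> V k \<omega>" for k \<omega>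
    using order_trans[OF zero_le_power2 energy_ge[of T, OF T_norm]] B by (simp add: V_def)
  have rec: "expectation (V (Suc k)) \<le> q * expectation (V k) + (B * \<alpha>\<^sup>2 * \<nu>\<^sup>2) * (real k + 1) powr (- v)" for k
  proof -
    have wk: "integrable M (\<lambda>\<omega>. (norm (w k \<omega>))\<^sup>2)"
      "expectation (\<lambda>\<omega>. (norm (w k \<omega>))\<^sup>2) \<le> \<nu>\<^sup>2 * (real k + 1) powr (- v)"
      using w_bound e_sq by auto
    have "expectation (V (Suc k)) \<le> expectation (\<lambda>\<omega>. q * V k \<omega> + B * \<alpha>\<^sup>2 * (norm (w k \<omega>))\<^sup>2)"
    proof (rule integral_mono[OF V_int])
      show "integrable M (\<lambda>\<omega>. q * V k \<omega> + B * \<alpha>\<^sup>2 * (norm (w k \<omega>))\<^sup>2)"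
        using V_int wk by simp
      show "V (Suc k) \<omega> \<le> q * V k \<omega> + B * \<alpha>\<^sup>2 * (norm (w k \<omega>))\<^sup>2" for \<omega>
        unfolding V_def e_step ep_Suc
        using contr[of "e k \<omega>" "ep k \<omega>" "(- \<alpha>) *\<^sub>R w k \<omega>"] by (simp add: power_mult_distrib mult.assoc)
    qed
    also have "\<dots> = q * expectation (V k) + B * \<alpha>\<^sup>2 * expectation (\<lambda>\<omega>. (norm (w k \<omega>))\<^sup>2)"
      using V_int wk by simp
    also have "\<dots> \<le> q * expectation (V k) + B * \<alpha>\<^sup>2 * (\<nu>\<^sup>2 * (real k + 1) powr (- v))"
      using B by (intro add_left_mono mult_left_mono wk) auto
    finally show ?thesis by (simp add: mult.assoc)
  qed
  obtain C where C: "C > 0" "\<And>k. expectation (V k) \<le> C * (real k + 1) powr (- v)"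
    by (rule powr_decay_recursion[OF rec q _ v])
       (use B V_nonneg in \<open>auto intro!: Bochner_Integration.integral_nonneg\<close>)
  show ?thesis
  \<comment> \<open>Only \<open>0 \<le> D\<close> is known, so 1 is added to make the constant
    positive.\<close>
  proof (intro exI[of _ "D * C + 1"] conjI allI)
    show "D * C + 1 > 0" using B C by (simp add: add_nonneg_pos)
    fix k
    have eq: "(norm (x (Suc k) \<omega> - xstar, x k \<omega> - xstar))\<^sup>2 = (norm (e (Suc k) \<omega>))\<^sup>2 + (norm (e k \<omega>))\<^sup>2" for \<omega>
      by (simp add: norm_Pair e_def)
    have int: "integrable M (\<lambda>\<omega>. (norm (e (Suc k) \<omega>))\<^sup>2 + (norm (e k \<omega>))\<^sup>2)"
      using e_sq[of "Suc k"] e_sq[of k] by simp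
    then show "integrable M (\<lambda>\<omega>. (norm (x (Suc k) \<omega> - xstar, x k \<omega> - xstar))\<^sup>2)"
      unfolding eq .
    \<comment> \<open>Since \<open>ep (Suc k) = e k\<close>, the pair is controlled by
      \<open>V\<close> at \<open>Suc k\<close>, not at \<open>k\<close>; the sharper decay at
      \<open>Suc k\<close> is relaxed to \<open>k\<close> at the end.\<close>
    have "expectation (\<lambda>\<omega>. (norm (e (Suc k) \<omega>))\<^sup>2 + (norm (e k \<omega>))\<^sup>2) \<le> expectation (\<lambda>\<omega>. D * V (Suc k) \<omega>)"
      using dom by (intro integral_mono[OF int] integrable_mult_right V_int) (simp add: V_def ep_Suc)
    also have "\<dots> = D * expectation (V (Suc k))" by simp
    also have "\<dots> \<le> D * (C * (real (Suc k) + 1) powr (- v))"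
      using B by (intro mult_left_mono C(2))
    also have "\<dots> \<le> D * (C * (real k + 1) powr (- v))"
      using B C v by (intro mult_left_mono powr_mono2') auto
    also have "\<dots> \<le> (D * C + 1) * (real k + 1) powr (- v)" by (simp add: algebra_simps)
    finally show "expectation (\<lambda>\<omega>. (norm (x (Suc k) \<omega> - xstar, x k \<omega> - xstar))\<^sup>2)
        \<le> (D * C + 1) * (real k + 1) powr (- v)"
      unfolding eq .
  qed
qed

end
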